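(* There exist a complete separable metric space $(\mathcal{X},d)$, a compact interval $I=[0,T]$, exponents $1<p<\infty$ and $\frac1p<\alpha<1$, and a curve $(\mu_t)\in W^{\alpha,p}(I;P_p(\mathcal{X}))$ which is not compatible in $P_p(\mathcal{X})$, such that $(\mu_t)$ has exactly one lift $\pi$ on continuous paths (i.e. exactly one $\pi\in P(C(I;\mathcal{X}))$ with $(e_t)_\#\pi=\mu_t$ for all $t\in I$), and this lift satisfies $$\int_{C(I;\mathcal{X})}|\gamma|_{W^{\alpha,p}}^p\,d\pi(\gamma)=+\infty .$$
   Context: $C(I;\mathcal{X})$ is the space of continuous paths with the supremum distance and its Borel $\sigma$-algebra; $P(\mathcal{Y})$ denotes Borel probability measures on $\mathcal{Y}$; $e_t(\gamma)=\gamma_t$. $P_p(\mathcal{X})$ is the set of Borel probability measures with finite $p$-th moment, with the $p$-Wasserstein distance $W_p$. For a metric space $(\mathcal{Y},\rho)$ and a path $X:[0,T]\to\mathcal{Y}$, $|X|_{W^{\alpha,p}}=\big(\iint_{[0,T]^2}\rho(X_s,X_t)^p|t-s|^{-1-\alpha p}\,ds\,dt\big)^{1/p}$, and (for $\alpha>1/p$) $W^{\alpha,p}([0,T];\mathcal{Y})$ is the set of continuous paths with $|X|_{W^{\alpha,p}}<\infty$. For curves of measures take $(\mathcal{Y},\rho)=(P_p(\mathcal{X}),W_p)$. Compatibility: a collection $\mathcal{M}\subset P_p(\mathcal{X})$ is compatible if for every finite subcollection of $\mathcal{M}$ there exists a multi-coupling (a probability measure on the finite product of copies of $\mathcal{X}$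 with the given one-dimensional marginals) such that all of its two-dimensional marginals are optimal couplings for the cost $d(x,y)^p$. *)

theory Defs
  imports "HOL-Probability.Probability"
begin

section \<open>Borel measures on metric spaces\<close>

text \<open>
  Metric spaces are elements of \<^typ>\<open>'a metric\<close>, that is, a carrier \<^term>\<open>mspace m\<close> inside a type
  together with a distance \<^term>\<open>mdist m\<close>; the distance is not tied to any topology on the type.
\<close>

definition borel_metric :: "'a metric \<Rightarrow> 'a measure" where
  "borel_metric m = sigma (mspace m) {U. openin (mtopology_of m) U}"

definition borel_prob :: "'a metric \<Rightarrow> 'a measure set" where
  "borel_prob m = {\<mu>. prob_space \<mu> \<and> sets \<mu> = sets (borel_metric m)}"

definition prob_moment :: "real \<Rightarrow> 'a metric \<Rightarrow> 'a measure set" where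
  "prob_moment p m = {\<mu> \<in> borel_prob m.
     \<exists>a \<in> mspace m. (\<integral>\<^sup>+ x. ennreal (mdist m a x powr p) \<partial>\<mu>) < \<infinity>}"


section \<open>Optimal transport\<close>

text \<open>
  For separable \<^term>\<open>m\<close> the binary and finite product \<open>\<sigma>\<close>-algebras used below are the Borel
  \<open>\<sigma>\<close>-algebras of the product spaces.
\<close>

definition couplings :: "'a metric \<Rightarrow> 'a measure \<Rightarrow> 'a measure \<Rightarrow> ('a \<times> 'a) measure set" where
  "couplings m \<mu> \<nu> = {q. prob_space q \<and>
     sets q = sets (borel_metric m \<Otimes>\<^sub>M borel_metric m) \<and>
     distr q (borel_metric m) fst = \<mu> \<and> distr q (borel_metric m) snd = \<nu>}"

definition transport_cost :: "real \<Rightarrow> 'a metric \<Rightarrow> ('a \<times> 'a) measure \<Rightarrow> ennreal" where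
  "transport_cost p m q = (\<integral>\<^sup>+ (x, y). ennreal (mdist m x y powr p) \<partial>q)"

definition optimal_couplings ::
  "real \<Rightarrow> 'a metric \<Rightarrow> 'a measure \<Rightarrow> 'a measure \<Rightarrow> ('a \<times> 'a) measure set" where
  "optimal_couplings p m \<mu> \<nu> = {q \<in> couplings m \<mu> \<nu>.
     \<forall>r \<in> couplings m \<mu> \<nu>. transport_cost p m q \<le> transport_cost p m r}"

text \<open>
  The infimum is finite for \<^term>\<open>\<mu>\<close> and \<^term>\<open>\<nu>\<close> in \<^term>\<open>prob_moment p m\<close>, the only measures
  between which the distance is used, so \<^const>\<open>enn2real\<close> loses nothing.
\<close>

definition wasserstein :: "real \<Rightarrow> 'a metric \<Rightarrow> 'a measure \<Rightarrow> 'a measure \<Rightarrow> real" where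
  "wasserstein p m \<mu> \<nu> =
     enn2real (INF q \<in> couplings m \<mu> \<nu>. transport_cost p m q) powr (1 / p)"

text \<open>
  A multi-coupling of a finite set \<^term>\<open>F\<close> of measures lives on the product of copies of the space
  indexed by the members of \<^term>\<open>F\<close> themselves.
\<close>

definition multi_couplings :: "'a metric \<Rightarrow> 'a measure set \<Rightarrow> ('a measure \<Rightarrow> 'a) measure set" where
  "multi_couplings m F = {Q. prob_space Q \<and>
     sets Q = sets (Pi\<^sub>M F (\<lambda>_. borel_metric m)) \<and>
     (\<forall>\<mu> \<in> F. distr Q (borel_metric m) (\<lambda>\<omega>. \<omega> \<mu>) = \<mu>)}"

definition compatible :: "real \<Rightarrow> 'a metric \<Rightarrow> 'a measure set \<Rightarrow> bool" where
  "compatible p m \<M> \<longleftrightarrow> (\<forall>F. finite F \<and> F \<subseteq> \<M> \<longrightarrow>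
     (\<exists>Q \<in> multi_couplings m F. \<forall>\<mu> \<in> F. \<forall>\<nu> \<in> F. \<mu> \<noteq> \<nu> \<longrightarrow>
        distr Q (borel_metric m \<Otimes>\<^sub>M borel_metric m) (\<lambda>\<omega>. (\<omega> \<mu>, \<omega> \<nu>))
          \<in> optimal_couplings p m \<mu> \<nu>))"


section \<open>Fractional Sobolev paths\<close>

text \<open>Real powers in \<open>[0,\<infinity>]\<close>, for positive exponents.\<close>

definition enn_powr :: "ennreal \<Rightarrow> real \<Rightarrow> ennreal" where
  "enn_powr x r = (if x = \<infinity> then \<infinity> else ennreal (enn2real x powr r))"

text \<open>
  The space of values is passed as a bare carrier \<^term>\<open>Y\<close> and distance \<^term>\<open>\<rho>\<close>, so that the
  definitions apply to \<^const>\<open>wasserstein\<close> without first proving the triangle inequality for it.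
  On the diagonal the integrand below is \<^term>\<open>0\<close>; the diagonal is a null set.
\<close>

definition sobolev_seminorm ::
  "('b \<Rightarrow> 'b \<Rightarrow> real) \<Rightarrow> real \<Rightarrow> real \<Rightarrow> real \<Rightarrow> (real \<Rightarrow> 'b) \<Rightarrow> ennreal" where
  "sobolev_seminorm \<rho> \<alpha> p T X = enn_powr
     (\<integral>\<^sup>+ z \<in> {0..T} \<times> {0..T}.
        (case z of (s, t) \<Rightarrow> ennreal (\<rho> (X s) (X t) powr p * \<bar>t - s\<bar> powr (- 1 - \<alpha> * p)))
      \<partial>(lborel \<Otimes>\<^sub>M lborel))
     (1 / p)"

definition sobolev_path ::
  "'b set \<Rightarrow> ('b \<Rightarrow> 'b \<Rightarrow> real) \<Rightarrow> real \<Rightarrow> real \<Rightarrow> real \<Rightarrow> (real \<Rightarrow> 'b) \<Rightarrow> bool" where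
  "sobolev_path Y \<rho> \<alpha> p T X \<longleftrightarrow>
     (\<forall>t \<in> {0..T}. X t \<in> Y) \<and>
     (\<forall>t \<in> {0..T}. ((\<lambda>s. \<rho> (X s) (X t)) \<longlongrightarrow> 0) (at t within {0..T})) \<and>
     sobolev_seminorm \<rho> \<alpha> p T X < \<infinity>"


section \<open>Lifts to path space\<close>

text \<open>
  \<^const>\<open>cfunspace\<close> carries the supremum distance; its elements are the bounded continuous functions
  on the interval, which by compactness are all the continuous ones, extended by \<^const>\<open>undefined\<close>
  outside it.
\<close>

definition path_space :: "real \<Rightarrow> 'a metric \<Rightarrow> (real \<Rightarrow> 'a) metric" where
  "path_space T m = cfunspace (top_of_set {0..T}) m"

definition lifts :: "real \<Rightarrow> 'a metric \<Rightarrow> (real \<Rightarrow> 'a measure) \<Rightarrow> (real \<Rightarrow> 'a) measure set" where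
  "lifts T m \<mu> = {\<pi> \<in> borel_prob (path_space T m).
     \<forall>t \<in> {0..T}. distr \<pi> (borel_metric m) (\<lambda>\<gamma>. \<gamma> t) = \<mu> t}"


section \<open>A universe for separable metric spaces\<close>

text \<open>
  Types cannot be quantified existentially. Every separable metric space, on whatever type, is
  isometric to one with carrier inside \<^typ>\<open>nat \<Rightarrow> real\<close> (send a point to its distances from a dense
  sequence), so quantifying over \<^typ>\<open>(nat \<Rightarrow> real) metric\<close> ranges over all of them up to isometry.
\<close>

lemma separable_metric_universe:
  fixes Y :: "'a metric"
  assumes "separable_space (mtopology_of Y)"
  shows "\<exists>(m :: (nat \<Rightarrow> real) metric) f. bij_betw f (mspace Y) (mspace m) \<and>
           (\<forall>x \<in> mspace Y. \<forall>y \<in> mspace Y. mdist m (f x) (f y) = mdist Y x y)"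
proof -
  let ?M = "mspace Y" and ?d = "mdist Y"
  interpret Y: Metric_space ?M ?d by simp
  obtain C where C: "countable C" "C \<subseteq> ?M" "Y.mtopology closure_of C = ?M"
    using assms unfolding separable_space_def mtopology_of_def by auto
  define f where "f x = (\<lambda>n::nat. ?d x (from_nat_into C n))" for x
  have inj: "inj_on f ?M"
  proof (rule inj_onI, rule ccontr)
    fix x y assume xy: "x \<in> ?M" "y \<in> ?M" "f x = f y" "x \<noteq> y"
    then have pos: "?d x y / 2 > 0" by simp
    have "x \<in> Y.mtopology closure_of C" using C xy by simp
    then obtain c where c: "c \<in> C" "c \<in> Y.mball x (?d x y / 2)"
      unfolding Y.metric_closure_of using pos by blast
    obtain n where n: "c = from_nat_into C n"
      using c C by (metis from_nat_into_surj)
    have "?d x c = ?d y c" using fun_cong[OF xy(3), of n] by (simp add: f_def n)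
    moreover have "?d x c < ?d x y / 2" using c by simp
    moreover have "?d x y \<le> ?d x c + ?d c y" using c C xy by (intro Y.triangle) auto
    ultimately show False using mdist_commute[of Y c y] by linarith
  qed
  define g where "g = inv_into ?M f"
  have g: "g (f x) = x" if "x \<in> ?M" for x using that inj by (simp add: g_def)
  interpret X: Metric_space "f ` ?M" "\<lambda>u v. ?d (g u) (g v)"
  proof
    fix u v w
    show "0 \<le> ?d (g u) (g v)" "?d (g u) (g v) = ?d (g v) (g u)"
      by (simp_all add: mdist_commute)
    show "?d (g u) (g v) = 0 \<longleftrightarrow> u = v" if "u \<in> f ` ?M" "v \<in> f ` ?M"
      using that by (auto simp: g)
    show "?d (g u) (g w) \<le> ?d (g u) (g v) + ?d (g v) (g w)"
      if "u \<in> f ` ?M" "v \<in> f ` ?M" "w \<in> f ` ?M"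
      using that by (auto simp: g intro: Y.triangle)
  qed
  show ?thesis
    by (rule exI[of _ X.Self], rule exI[of _ f])
      (auto simp: bij_betw_def inj g)
qed

end

theory Submission
  imports Defs
begin

text \<open>
  The space is a disjoint union of blocks. Block \<open>n\<close> consists of \<open>k = N^3\<close> parallel strands, \<open>N = 2^(n + 1)\<close>,
  wound \<open>N\<close> times per unit of time around a circle of length 1, and \<open>\<mu>\<^sub>t\<close> puts mass \<open>1 / (2^(n + 1) * k)\<close>
  on each of its \<open>k\<close> equally spaced points at time \<open>t\<close>. The configuration is the same again each
  time the circle turns by \<open>1 / k\<close>, so optimal transport sees a displacement of at most
  \<open>1 / k\<close> and \<open>\<mu>\<close> is \<open>3/4\<close>-Hoelder uniformly in \<open>n\<close>, whereas a continuous path has to stay on its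
  strand: the lift is unique, and a strand of block \<open>n\<close> has energy at least of order \<open>N\<close>, whose
  mean diverges. With \<open>p = 4\<close> and \<open>\<alpha> = 1/2\<close> the kernel is \<open>\<bar>t - s\<bar>^(-3)\<close>, which the Hoelder bound
  compensates exactly.
\<close>

section \<open>Distance to the nearest integer\<close>

definition circ :: "real \<Rightarrow> real" where
  "circ x = \<bar>x - of_int (round x)\<bar>"

lemma circ_le: "circ x \<le> \<bar>x - of_int k\<bar>"
  unfolding circ_def by (rule round_diff_minimal)

lemma circ_ge: "(\<And>k::int. c \<le> \<bar>x - of_int k\<bar>) \<Longrightarrow> c \<le> circ x"
  unfolding circ_def by blast

lemma circ_nonneg [simp]: "0 \<le> circ x"
  by (simp add: circ_def)

lemma circ_0 [simp]: "circ 0 = 0"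
  by (simp add: circ_def)

lemma circ_le_abs: "circ x \<le> \<bar>x\<bar>"
  using circ_le[of x 0] by simp

lemma circ_le_half: "circ x \<le> 1 / 2"
  unfolding circ_def using of_int_round_abs_le[of x] by (simp add: abs_minus_commute)

lemma circ_minus [simp]: "circ (- x) = circ x"
proof -
  have "circ (- y) \<le> circ y" for y
    using circ_le[of "- y" "- round y"] by (simp add: circ_def abs_minus_commute)
  from this[of x] this[of "- x"] show ?thesis by simp
qed

lemma circ_triangle: "circ (x + y) \<le> circ x + circ y"
  using circ_le[of "x + y" "round x + round y"] by (simp add: circ_def)

lemma circ_eq_abs: "\<bar>x\<bar> < 1 / 2 \<Longrightarrow> circ x = \<bar>x\<bar>"
  using round_unique'[of x 0] by (simp add: circ_def)

text \<open>Every \<open>a - k * l\<close> is a nonzero integer, hence at least 1 in absolute value.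
  At a fixed time this is the spacing of the strands of a block.\<close>

lemma circ_fraction_ge:
  assumes "0 < k" "\<not> k dvd a"
  shows "1 / real_of_int k \<le> circ (of_int a / of_int k)"
proof (rule circ_ge)
  fix l :: int
  have "a - k * l \<noteq> 0" using assms(2) by auto
  then have "1 \<le> real_of_int \<bar>a - k * l\<bar>" by linarith
  moreover have "\<bar>real_of_int a / of_int k - of_int l\<bar> = real_of_int \<bar>a - k * l\<bar> / of_int k"
    using assms(1) by (simp add: field_simps abs_divide)
  ultimately show "1 / real_of_int k \<le> \<bar>real_of_int a / of_int k - of_int l\<bar>"
    using assms(1) by (simp add: divide_right_mono)
qed

text \<open>Multiplication by \<open>k\<close> carries the multiples of 1/k to the integers, so the
  left side is the distance from \<open>x\<close> to that lattice. The next lemma shows that it is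
  attained when \<open>a\<close> is congruent to \<open>- round (k * x)\<close> modulo
  \<open>k\<close>.\<close>

lemma circ_shift_ge:
  assumes "0 < k"
  shows "circ (of_int k * x) / of_int k \<le> circ (x + of_int a / of_int k)"
proof (rule circ_ge)
  fix l :: int
  have "\<bar>x + of_int a / of_int k - of_int l\<bar> = \<bar>of_int k * x - of_int (k * l - a)\<bar> / of_int k"
    using assms by (simp add: field_simps abs_divide)
  then show "circ (of_int k * x) / of_int k \<le> \<bar>x + of_int a / of_int k - of_int l\<bar>"
    using assms circ_le[of "of_int k * x" "k * l - a"] by (simp add: divide_right_mono)
qed

lemma circ_shift_le:
  assumes "0 < k" "k dvd a + round (of_int k * x)"
  shows "circ (x + of_int a / of_int k) \<le> circ (of_int k * x) / of_int k"
proof -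
  obtain l where l: "a = k * l - round (of_int k * x)"
    using assms(2) by (metis add_diff_cancel_right' dvdE)
  have "\<bar>x + of_int a / of_int k - of_int l\<bar> = circ (of_int k * x) / of_int k"
    using assms(1) by (simp add: l circ_def field_simps abs_divide)
  then show ?thesis using circ_le[of "x + of_int a / of_int k" l] by simp
qed


section \<open>A space of winding strands\<close>

text \<open>The growth is matched to the weight 2^-(n+1) of block \<open>n\<close>: the product of
  the two does not depend on \<open>n\<close>, so the mean winding is infinite.\<close>

definition winding :: "nat \<Rightarrow> int" where
  "winding n = 2 ^ Suc n"

definition strands :: "nat \<Rightarrow> int" where
  "strands n = winding n ^ 3"

lemma winding_ge: "2 \<le> winding n"
  using one_le_power[of "2::int" n] by (simp add: winding_def)

lemma strands_pos: "0 < strands n"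
  using winding_ge[of n] by (simp add: strands_def)

text \<open>Time and strand are packed into one sequence of reals; coordinate 1 holds the block and
  every later one the index, and \<open>strand_of\<close> reads both back by rounding down.\<close>

definition point :: "real \<Rightarrow> nat \<times> int \<Rightarrow> nat \<Rightarrow> real" where
  "point t s = (\<lambda>j. if j = 0 then t else if j = 1 then real (fst s) else of_int (snd s))"

definition time_of :: "(nat \<Rightarrow> real) \<Rightarrow> real" where
  "time_of x = x 0"

definition strand_of :: "(nat \<Rightarrow> real) \<Rightarrow> nat \<times> int" where
  "strand_of x = (nat \<lfloor>x 1\<rfloor>, \<lfloor>x 2\<rfloor>)"

lemma time_of_point [simp]: "time_of (point t s) = t"
  by (simp add: time_of_def point_def)

lemma strand_of_point [simp]: "strand_of (point t s) = s"
  by (simp add: strand_of_def point_def)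

definition strand_set :: "(nat \<times> int) set" where
  "strand_set = Sigma UNIV (\<lambda>n. {0..<strands n})"

definition helix_set :: "(nat \<Rightarrow> real) set" where
  "helix_set = (\<lambda>(t, s). point t s) ` (UNIV \<times> strand_set)"

lemma point_in_helix_set [simp]: "point t s \<in> helix_set \<longleftrightarrow> s \<in> strand_set"
proof
  assume "point t s \<in> helix_set"
  then obtain t' s' where "point t s = point t' s'" "s' \<in> strand_set"
    by (auto simp: helix_set_def)
  then show "s \<in> strand_set" by (metis strand_of_point)
qed (auto simp: helix_set_def)

lemma helix_setE:
  assumes "x \<in> helix_set"
  obtains t s where "x = point t s" "s \<in> strand_set"
  using assms by (auto simp: helix_set_def)

lemma helix_set_eq: "x \<in> helix_set \<Longrightarrow> x = point (time_of x) (strand_of x)"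
  by (erule helix_setE) simp

lemma strand_of_in: "x \<in> helix_set \<Longrightarrow> strand_of x \<in> strand_set"
  by (erule helix_setE) simp

text \<open>Strand \<open>(n, i)\<close> has at time \<open>t\<close> the angle
  \<open>winding n * t + i / strands n\<close> on a circle of length 1, so within a block this is
  the circular distance at times that differ by \<open>u\<close>. The value 1 for different blocks
  exceeds every circular distance.\<close>

definition strand_gap :: "real \<Rightarrow> nat \<times> int \<Rightarrow> nat \<times> int \<Rightarrow> real" where
  "strand_gap u a b = (if fst a = fst b
     then circ (of_int (winding (fst a)) * u + of_int (snd a - snd b) / of_int (strands (fst a)))
     else 1)"

definition helix_dist :: "(nat \<Rightarrow> real) \<Rightarrow> (nat \<Rightarrow> real) \<Rightarrow> real" where
  "helix_dist x y = \<bar>time_of x - time_of y\<bar> +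
     strand_gap (time_of x - time_of y) (strand_of x) (strand_of y)"

section \<open>Metric axioms for the space of strands\<close>

lemma strand_gap_nonneg [simp]: "0 \<le> strand_gap u a b"
  by (simp add: strand_gap_def)

lemma strand_gap_le: "strand_gap u a b \<le> 1"
  unfolding strand_gap_def using circ_le_half by (smt (verit) field_sum_of_halves)

lemma strand_gap_commute: "strand_gap (- u) b a = strand_gap u a b"
proof (cases "fst a = fst b")
  case True
  have "of_int (winding (fst b)) * (- u) + of_int (snd b - snd a) / of_int (strands (fst b)) =
    - (of_int (winding (fst b)) * u + of_int (snd a - snd b) / of_int (strands (fst b)) :: real)"
    by (simp add: diff_divide_distrib)
  then show ?thesis
    unfolding strand_gap_def by (simp only: True if_True circ_minus)
qed (simp add: strand_gap_def)

text \<open>Within one block this is the triangle inequality of the circle. Otherwise at least one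
  gap on the right is 1, and no gap exceeds 1.\<close>

lemma strand_gap_triangle: "strand_gap (u + v) a c \<le> strand_gap u a b + strand_gap v b c"
proof (cases "fst a = fst b \<and> fst b = fst c")
  case True
  have "of_int (winding (fst c)) * (u + v) + of_int (snd a - snd c) / of_int (strands (fst c)) =
    (of_int (winding (fst c)) * u + of_int (snd a - snd b) / of_int (strands (fst c))) +
    (of_int (winding (fst c)) * v + of_int (snd b - snd c) / of_int (strands (fst c)) :: real)"
    by (simp add: algebra_simps diff_divide_distrib)
  then show ?thesis
    unfolding strand_gap_def using True by (simp only: circ_triangle if_True refl)
next
  case False
  then show ?thesis
    using strand_gap_le[of "u + v" a c] strand_gap_nonneg[of u a b] strand_gap_nonneg[of v b c]
    by (auto simp: strand_gap_def)
qed

lemma strand_eqI: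
  assumes "a \<in> strand_set" "b \<in> strand_set" "fst a = fst b" "strands (fst a) dvd snd a - snd b"
  shows "a = b"
proof -
  have "snd a mod strands (fst a) = snd b mod strands (fst a)"
    using assms(4) by (simp add: mod_eq_dvd_iff)
  then show ?thesis using assms by (auto simp: strand_set_def)
qed

lemma strand_gap_zero:
  assumes "a \<in> strand_set" "b \<in> strand_set" "strand_gap 0 a b < 1 / of_int (strands (fst a))"
  shows "a = b"
proof (cases "fst a = fst b")
  case True
  then have "strands (fst a) dvd snd a - snd b"
    using assms(3) circ_fraction_ge[of "strands (fst a)" "snd a - snd b"] strands_pos[of "fst a"]
    by (auto simp: strand_gap_def)
  then show ?thesis using assms True by (intro strand_eqI)
next
  case False
  have "1 / real_of_int (strands (fst a)) \<le> 1" using strands_pos[of "fst a"] by simp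
  then show ?thesis using False assms(3) by (simp add: strand_gap_def)
qed

lemma helix_Metric_space: "Metric_space helix_set helix_dist"
proof
  fix x y z
  show "0 \<le> helix_dist x y" by (simp add: helix_dist_def)
  show "helix_dist x y = helix_dist y x"
    using strand_gap_commute[of "time_of x - time_of y"] by (simp add: helix_dist_def)
  show "helix_dist x z \<le> helix_dist x y + helix_dist y z"
    using strand_gap_triangle[of "time_of x - time_of y" "time_of y - time_of z"
        "strand_of x" "strand_of z" "strand_of y"]
    by (simp add: helix_dist_def)
  assume xy: "x \<in> helix_set" "y \<in> helix_set"
  show "helix_dist x y = 0 \<longleftrightarrow> x = y"
  proof
    assume "helix_dist x y = 0"
    then have "\<bar>time_of x - time_of y\<bar> = 0"
      "strand_gap (time_of x - time_of y) (strand_of x) (strand_of y) = 0"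
      using strand_gap_nonneg[of "time_of x - time_of y" "strand_of x" "strand_of y"]
      unfolding helix_dist_def by linarith+
    then have "time_of x = time_of y" "strand_of x = strand_of y"
      using xy strands_pos[of "fst (strand_of x)"]
      by (auto intro!: strand_gap_zero strand_of_in)
    then show "x = y" using xy helix_set_eq by metis
  qed (simp add: helix_dist_def strand_gap_def)
qed

definition helix :: "(nat \<Rightarrow> real) metric" where
  "helix = metric (helix_set, helix_dist)"

lemma mspace_helix [simp]: "mspace helix = helix_set"
  unfolding helix_def by (rule Metric_space.mspace_metric[OF helix_Metric_space])

lemma mdist_helix [simp]: "mdist helix = helix_dist"
  unfolding helix_def by (rule Metric_space.mdist_metric[OF helix_Metric_space])

interpretation helix: Metric_space helix_set helix_dist
  rewrites "helix.mtopology = mtopology_of helix"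
  by (rule helix_Metric_space) (simp add: mtopology_of_def)

lemma helix_dist_same_strand:
  "helix_dist (point s a) (point t a) =
     \<bar>s - t\<bar> + circ (of_int (winding (fst a)) * (s - t))"
  by (simp add: helix_dist_def strand_gap_def)

lemma helix_dist_same_strand_le:
  "helix_dist (point s a) (point t a) \<le> (1 + of_int (winding (fst a))) * \<bar>s - t\<bar>"
proof -
  have "\<bar>of_int (winding (fst a)) * (s - t)\<bar> = of_int (winding (fst a)) * \<bar>s - t\<bar>"
    using winding_ge[of "fst a"] by (simp add: abs_mult)
  then show ?thesis
    using circ_le_abs[of "of_int (winding (fst a)) * (s - t)"]
    by (simp add: helix_dist_same_strand distrib_right)
qed

lemma time_le_helix_dist: "\<bar>time_of x - time_of y\<bar> \<le> helix_dist x y"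
  by (simp add: helix_dist_def)

text \<open>Strands are uniformly isolated within a block, so each of them is open and closed.\<close>

definition isolation :: "nat \<Rightarrow> real" where
  "isolation n = 1 / (of_int (strands n) * of_int (winding n))"

lemma isolation_pos: "0 < isolation n"
  using strands_pos[of n] winding_ge[of n] by (simp add: isolation_def)

text \<open>Slide \<open>y\<close> along its own strand to the time of \<open>x\<close>: on the
  circle this moves it by at most \<open>winding n * \<bar>u\<bar>\<close>. The gap at equal times
  is then below the spacing \<open>1 / strands n\<close>, which forces the strands to agree.\<close>

lemma strand_of_eqI:
  assumes "x \<in> helix_set" "y \<in> helix_set" "helix_dist x y < isolation (fst (strand_of x))"
  shows "strand_of y = strand_of x"
proof -
  define n u where "n = fst (strand_of x)" and "u = time_of x - time_of y"
  have N: "1 \<le> real_of_int (winding n)" using winding_ge[of n] by linarith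
  have k: "1 \<le> real_of_int (strands n)" using strands_pos[of n] by linarith
  have lt: "\<bar>u\<bar> + strand_gap u (strand_of x) (strand_of y) < isolation n"
    using assms(3) by (simp add: helix_dist_def n_def u_def)
  have "isolation n \<le> 1"
    unfolding isolation_def using mult_mono[OF k N] k by (simp add: divide_le_eq_1)
  then have same: "fst (strand_of y) = n"
    using lt by (auto simp: strand_gap_def n_def split: if_splits)
  have "strand_gap 0 (strand_of x) (strand_of y) \<le>
      strand_gap u (strand_of x) (strand_of y) + strand_gap (- u) (strand_of y) (strand_of y)"
    using strand_gap_triangle[of u "- u" "strand_of x" "strand_of y" "strand_of y"] by simp
  also have "strand_gap (- u) (strand_of y) (strand_of y) \<le> of_int (winding n) * \<bar>u\<bar>"
    using circ_le_abs[of "of_int (winding n) * u"] N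
    by (simp add: strand_gap_def same abs_mult)
  also have "strand_gap u (strand_of x) (strand_of y) + of_int (winding n) * \<bar>u\<bar> \<le>
      of_int (winding n) * (\<bar>u\<bar> + strand_gap u (strand_of x) (strand_of y))"
    using mult_right_mono[OF N strand_gap_nonneg[of u "strand_of x" "strand_of y"]]
    by (simp add: algebra_simps)
  also have "\<dots> < of_int (winding n) * isolation n"
    using lt N by (intro mult_strict_left_mono) auto
  also have "\<dots> = 1 / of_int (strands n)"
    using N by (simp add: isolation_def)
  finally show ?thesis
    using assms strand_gap_zero[of "strand_of x" "strand_of y"] by (simp add: n_def strand_of_in)
qed

text \<open>Different blocks are at distance at least 1, so a Cauchy sequence settles in one block.
  It then settles on one strand, where the distance is Lipschitz in time, and the times converge in
  the reals.\<close>

lemma helix_mcomplete: "mcomplete_of helix"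
proof -
  have "\<exists>x. limitin (mtopology_of helix) f x sequentially" if f: "helix.MCauchy f" for f
  proof -
    have mem: "f i \<in> helix_set" for i
      using f unfolding helix.MCauchy_def by blast
    have ex: "\<exists>K. \<forall>i\<ge>K. \<forall>j\<ge>K. helix_dist (f i) (f j) < e" if "0 < e" for e
      using f that unfolding helix.MCauchy_def by meson
    \<comment> \<open>The block has to be fixed first: \<open>isolation\<close> tends to 0 along the
      blocks, so it gives a positive threshold only within one of them.\<close>
    obtain K0 where K0: "\<And>i j. i \<ge> K0 \<Longrightarrow> j \<ge> K0 \<Longrightarrow> helix_dist (f i) (f j) < 1"
      using ex[of 1] by auto
    define n where "n = fst (strand_of (f K0))"
    obtain K where K: "\<And>i j. i \<ge> K \<Longrightarrow> j \<ge> K \<Longrightarrow> helix_dist (f i) (f j) < isolation n"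
      using ex[OF isolation_pos] by metis
    have n: "fst (strand_of (f i)) = n" if "i \<ge> K0" for i
    proof (rule ccontr)
      assume "fst (strand_of (f i)) \<noteq> n"
      then have "1 \<le> helix_dist (f i) (f K0)" by (simp add: helix_dist_def strand_gap_def n_def)
      then show False using K0[OF that order_refl] by simp
    qed
    define L where "L = max K0 K"
    define a where "a = strand_of (f L)"
    have a: "a \<in> strand_set" unfolding a_def using mem by (rule strand_of_in)
    have st: "f i = point (time_of (f i)) a" if "i \<ge> L" for i
    proof -
      have "strand_of (f i) = a"
        unfolding a_def using that by (intro strand_of_eqI mem) (simp add: n K L_def)
      then show ?thesis using helix_set_eq[OF mem[of i]] by simp
    qed
    have "Cauchy (\<lambda>i. time_of (f i))"
      unfolding Cauchy_altdef2 dist_real_def using ex time_le_helix_dist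
      by (meson le_less_trans order_refl)
    then obtain t where t: "(\<lambda>i. time_of (f i)) \<longlonglongrightarrow> t"
      using Cauchy_convergent_iff convergent_def by blast
    have "(\<lambda>i. (1 + of_int (winding (fst a))) * \<bar>time_of (f i) - t\<bar>) \<longlonglongrightarrow>
        (1 + of_int (winding (fst a))) * \<bar>t - t\<bar>"
      by (intro tendsto_intros t)
    then have 0: "(\<lambda>i. (1 + of_int (winding (fst a))) * \<bar>time_of (f i) - t\<bar>) \<longlonglongrightarrow> 0"
      by simp
    have "(\<lambda>i. helix_dist (f i) (point t a)) \<longlonglongrightarrow> 0"
    proof (rule tendsto_sandwich[OF _ _ tendsto_const 0])
      show "eventually (\<lambda>i. helix_dist (f i) (point t a) \<le>
          (1 + of_int (winding (fst a))) * \<bar>time_of (f i) - t\<bar>) sequentially"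
        using eventually_ge_at_top[of L]
      proof eventually_elim
        case (elim i)
        show ?case using helix_dist_same_strand_le[of "time_of (f i)" a t] st[OF elim] by simp
      qed
    qed simp
    then have "limitin (mtopology_of helix) f (point t a) sequentially"
      by (simp add: helix.limitin_metric_dist_null mem a)
    then show ?thesis by blast
  qed
  then show ?thesis by (simp add: mcomplete_of_def helix.mcomplete_def)
qed

text \<open>Points with rational time are dense on each of the countably many strands.\<close>

lemma helix_separable: "separable_space (mtopology_of helix)"
  unfolding separable_space_def
proof (intro exI conjI)
  let ?C = "(\<lambda>(t, s). point t s) ` (\<rat> \<times> strand_set)"
  show "countable ?C"
    by (intro countable_image countable_SIGMA countable_rat countable_subset[of strand_set UNIV]) auto
  show C: "?C \<subseteq> topspace (mtopology_of helix)" by auto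
  have "\<exists>y\<in>?C. helix_dist (point t s) y < r" if s: "s \<in> strand_set" and r: "0 < r" for t s r
  proof -
    have N: "0 < 1 + real_of_int (winding (fst s))" using winding_ge[of "fst s"] by linarith
    obtain q where q: "q \<in> \<rat>" "t < q" "q < t + r / (1 + of_int (winding (fst s)))"
      using Rats_dense_in_real[of t "t + r / (1 + of_int (winding (fst s)))"] N r by auto
    then have "(1 + of_int (winding (fst s))) * \<bar>t - q\<bar> < r"
      using N by (simp add: field_simps)
    then have "helix_dist (point t s) (point q s) < r"
      using helix_dist_same_strand_le[of t s q] by linarith
    then show ?thesis using q s by auto
  qed
  then show "mtopology_of helix closure_of ?C = topspace (mtopology_of helix)"
    using C by (auto simp: helix.metric_closure_of elim!: helix_setE)
qed


section \<open>Borel measurability\<close>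

lemma space_borel_metric [simp]: "space (borel_metric m) = mspace m"
proof -
  have "{U. openin (mtopology_of m) U} \<subseteq> Pow (mspace m)"
    using openin_subset by fastforce
  then show ?thesis by (simp add: borel_metric_def space_measure_of_conv)
qed

lemma openin_sets_borel_metric: "openin (mtopology_of m) U \<Longrightarrow> U \<in> sets (borel_metric m)"
  using openin_subset unfolding borel_metric_def by (intro in_measure_of) fastforce+

lemma continuous_map_borel_metric:
  assumes "continuous_map (mtopology_of a) (mtopology_of b) f"
  shows "f \<in> borel_metric a \<rightarrow>\<^sub>M borel_metric b"
proof -
  have "f \<in> mspace a \<rightarrow> mspace b" using continuous_map_funspace[OF assms] by simp
  moreover have "f -` U \<inter> mspace a \<in> sets (borel_metric a)" if "openin (mtopology_of b) U" for U
    using openin_continuous_map_preimage[OF assms that]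
    by (intro openin_sets_borel_metric) (simp add: vimage_def Int_def conj_commute)
  ultimately show ?thesis
    unfolding borel_metric_def[of b] using openin_subset
    by (intro measurable_measure_of) fastforce+
qed

lemma continuous_map_eval_path_space:
  assumes t: "t \<in> {0..T}"
  shows "continuous_map (mtopology_of (path_space T m)) (mtopology_of m) (\<lambda>\<gamma>. \<gamma> t)"
proof -
  have "\<exists>\<delta>>0. \<forall>g. g \<in> mspace (path_space T m) \<and> mdist (path_space T m) f g < \<delta> \<longrightarrow>
      mdist m (f t) (g t) < e" if "f \<in> mspace (path_space T m)" "0 < e" for f e
  proof (intro exI conjI allI impI)
    fix g assume g: "g \<in> mspace (path_space T m) \<and> mdist (path_space T m) f g < e"
    have "mdist m (f t) (g t) \<le> mdist (path_space T m) f g"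
      using cfunspace_mdist_le[of f "top_of_set {0..T}" m g "mdist (path_space T m) f g"] g that t
      unfolding path_space_def by auto
    then show "mdist m (f t) (g t) < e" using g by simp
  qed (rule that)
  moreover have "(\<lambda>\<gamma>. \<gamma> t) ` mspace (path_space T m) \<subseteq> mspace m"
    using t by (auto simp: path_space_def)
  ultimately show ?thesis
    unfolding mtopology_of_def
    by (subst Metric_space.metric_continuous_map) auto
qed

lemma eval_path_space_measurable:
  "t \<in> {0..T} \<Longrightarrow> (\<lambda>\<gamma>. \<gamma> t) \<in> borel_metric (path_space T m) \<rightarrow>\<^sub>M borel_metric m"
  by (intro continuous_map_borel_metric continuous_map_eval_path_space)

text \<open>Without measurability of the integrand only one inequality survives.\<close>

lemma nn_integral_distr_le:
  assumes T: "T \<in> M \<rightarrow>\<^sub>M N"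
  shows "(\<integral>\<^sup>+ x. f x \<partial>distr M N T) \<le> (\<integral>\<^sup>+ x. f (T x) \<partial>M)"
  unfolding nn_integral_def[of "distr M N T"]
proof (rule SUP_least)
  fix g assume g: "g \<in> {g. simple_function (distr M N T) g \<and> g \<le> f}"
  then have "integral\<^sup>S (distr M N T) g = (\<integral>\<^sup>+ x. g x \<partial>distr M N T)"
    by (simp add: nn_integral_eq_simple_integral)
  also have "\<dots> = (\<integral>\<^sup>+ x. g (T x) \<partial>M)"
    using g T by (intro nn_integral_distr borel_measurable_simple_function) auto
  also have "\<dots> \<le> (\<integral>\<^sup>+ x. f (T x) \<partial>M)"
    using g by (intro nn_integral_mono) (auto simp: le_fun_def)
  finally show "integral\<^sup>S (distr M N T) g \<le> (\<integral>\<^sup>+ x. f (T x) \<partial>M)" .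
qed

text \<open>The ball of radius \<open>isolation\<close> about a point stays on its strand. An
  arbitrary \<open>P\<close> covers a strand and its complement alike, and makes
  \<open>strand_of\<close> measurable.\<close>

lemma openin_strand_of: "openin (mtopology_of helix) {x \<in> helix_set. P (strand_of x)}"
  unfolding helix.openin_mtopology
proof (intro conjI allI impI)
  fix x assume x: "x \<in> {x \<in> helix_set. P (strand_of x)}"
  have "helix.mball x (isolation (fst (strand_of x))) \<subseteq> {x \<in> helix_set. P (strand_of x)}"
  proof
    fix y assume y: "y \<in> helix.mball x (isolation (fst (strand_of x)))"
    then have "strand_of y = strand_of x" by (intro strand_of_eqI) auto
    then show "y \<in> {x \<in> helix_set. P (strand_of x)}" using x y by simp
  qed
  then show "\<exists>r>0. helix.mball x r \<subseteq> {x \<in> helix_set. P (strand_of x)}"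
    using isolation_pos by blast
qed blast

lemma measurable_strand_of_strand_set: "strand_of \<in> borel_metric helix \<rightarrow>\<^sub>M count_space strand_set"
proof (rule measurableI)
  fix A :: "(nat \<times> int) set"
  have "strand_of -` A \<inter> space (borel_metric helix) = {x \<in> helix_set. strand_of x \<in> A}" by auto
  then show "strand_of -` A \<inter> space (borel_metric helix) \<in> sets (borel_metric helix)"
    using openin_sets_borel_metric[OF openin_strand_of[of "\<lambda>s. s \<in> A"]] by simp
qed (simp add: strand_of_in)

lemma measurable_strand_of [measurable]: "strand_of \<in> borel_metric helix \<rightarrow>\<^sub>M count_space UNIV"
  using measurable_compose[OF measurable_strand_of_strand_set, of id "count_space UNIV"] by simp

lemma measurable_block [measurable]:
  "(\<lambda>x. f (fst (strand_of x)) :: ennreal) \<in> borel_measurable (borel_metric helix)"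
  by (rule measurable_compose[OF measurable_strand_of]) simp

lemma continuous_map_time_of: "continuous_map (mtopology_of helix) euclidean time_of"
proof -
  have "continuous_map (mtopology_of helix) (Met_TC.mtopology) time_of"
    unfolding helix.metric_continuous_map[OF Met_TC.Metric_space_axioms] dist_real_def
    using le_less_trans[OF time_le_helix_dist] by blast
  then show ?thesis by simp
qed

lemma measurable_time_of [measurable]: "time_of \<in> borel_measurable (borel_metric helix)"
proof (rule borel_measurableI)
  fix U :: "real set" assume "open U"
  then have "openin (mtopology_of helix) {x \<in> topspace (mtopology_of helix). time_of x \<in> U}"
    by (intro openin_continuous_map_preimage[OF continuous_map_time_of]) auto
  then show "time_of -` U \<inter> space (borel_metric helix) \<in> sets (borel_metric helix)"
    by (intro openin_sets_borel_metric) (simp add: vimage_def Int_def conj_commute)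
qed


section \<open>The curve of measures\<close>

text \<open>Each block is rotated by its own number of steps. Reduction modulo
  \<open>strands\<close> also sends indices outside \<open>strand_set\<close> into it, so
  \<open>turn (\<lambda>_. 0)\<close> fixes \<open>strand_set\<close> pointwise and repairs all
  other pairs.\<close>

definition turn :: "(nat \<Rightarrow> int) \<Rightarrow> nat \<times> int \<Rightarrow> nat \<times> int" where
  "turn a s = (fst s, (snd s + a (fst s)) mod strands (fst s))"

lemma fst_turn [simp]: "fst (turn a s) = fst s"
  by (simp add: turn_def)

lemma turn_in [simp]: "turn a s \<in> strand_set"
  using strands_pos[of "fst s"] by (simp add: turn_def strand_set_def)

lemma turn_turn [simp]: "turn a (turn b s) = turn (\<lambda>n. a n + b n) s"
  by (simp add: turn_def mod_simps ac_simps)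

definition strand_pmf :: "(nat \<times> int) pmf" where
  "strand_pmf = geometric_pmf (1 / 2) \<bind> (\<lambda>n. map_pmf (Pair n) (pmf_of_set {0..<strands n}))"

lemma bij_betw_add_mod:
  fixes k :: int assumes "0 < k"
  shows "bij_betw (\<lambda>i. (i + a) mod k) {0..<k} {0..<k}"
  by (rule bij_betw_byWitness[where f' = "\<lambda>i. (i - a) mod k"]) (use assms in \<open>auto simp: mod_simps\<close>)

text \<open>A rotation keeps the block and permutes its indices, which are uniformly distributed
  given the block.\<close>

lemma map_pmf_turn: "map_pmf (turn a) strand_pmf = strand_pmf"
proof -
  have "map_pmf (turn a) (map_pmf (Pair n) (pmf_of_set {0..<strands n})) =
      map_pmf (Pair n) (pmf_of_set {0..<strands n})" for n
  proof -
    have "map_pmf (turn a) (map_pmf (Pair n) (pmf_of_set {0..<strands n})) =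
        map_pmf (Pair n) (map_pmf (\<lambda>i. (i + a n) mod strands n) (pmf_of_set {0..<strands n}))"
      by (simp add: pmf.map_comp comp_def turn_def)
    also have "map_pmf (\<lambda>i. (i + a n) mod strands n) (pmf_of_set {0..<strands n}) =
        pmf_of_set {0..<strands n}"
      using strands_pos[of n] by (intro map_pmf_of_set_bij_betw bij_betw_add_mod) auto
    finally show ?thesis .
  qed
  then show ?thesis by (simp add: strand_pmf_def map_bind_pmf)
qed

lemma map_pmf_fst_strand_pmf: "map_pmf fst strand_pmf = geometric_pmf (1 / 2)"
  by (simp add: strand_pmf_def map_bind_pmf pmf.map_comp comp_def bind_return_pmf' flip: map_pmf_def)

text \<open>On the support of \<open>strand_pmf\<close> the inserted
  \<open>turn (\<lambda>_. 0)\<close> is the identity; it makes the map take values in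
  \<open>helix_set\<close> on the whole type, as measurability demands.\<close>

definition curve :: "real \<Rightarrow> (nat \<Rightarrow> real) measure" where
  "curve t = distr strand_pmf (borel_metric helix) (\<lambda>s. point t (turn (\<lambda>_. 0) s))"

lemma measurable_pmf_point [measurable]:
  "(\<lambda>s. point t (turn a s)) \<in> measure_pmf p \<rightarrow>\<^sub>M borel_metric helix"
  by (simp add: measurable_pmf_measure1)

lemma measurable_pmf_point_pair [measurable]:
  "(\<lambda>c. (point s (turn a c), point t (turn b c)))
     \<in> measure_pmf p \<rightarrow>\<^sub>M borel_metric helix \<Otimes>\<^sub>M borel_metric helix"
  by measurable

lemma distr_turn:
  assumes "f \<in> measure_pmf strand_pmf \<rightarrow>\<^sub>M N"
  shows "distr strand_pmf N (\<lambda>s. f (turn a s)) = distr strand_pmf N f"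
proof -
  have f: "f \<in> count_space UNIV \<rightarrow>\<^sub>M N" using assms by simp
  have "distr strand_pmf N f = distr (map_pmf (turn a) strand_pmf) N f"
    by (simp only: map_pmf_turn)
  also have "\<dots> = distr strand_pmf N (f \<circ> turn a)"
    unfolding map_pmf_rep_eq by (rule distr_distr) (use f in auto)
  finally show ?thesis by (simp add: comp_def)
qed

lemma sets_curve [simp, measurable_cong]: "sets (curve t) = sets (borel_metric helix)"
  by (simp add: curve_def)

lemma prob_space_curve: "prob_space (curve t)"
  unfolding curve_def by (rule measure_pmf.prob_space_distr) simp

lemma AE_curve_time_of: "AE x in curve t. time_of x = t"
proof -
  have "{x \<in> space (borel_metric helix). time_of x = t} \<in> sets (borel_metric helix)"
    by measurable
  then show ?thesis
    unfolding curve_def by (simp only: AE_distr_iff[OF measurable_pmf_point]) simp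
qed

lemma nn_integral_curve:
  "(\<integral>\<^sup>+ x. f (fst (strand_of x)) \<partial>curve t) = (\<integral>\<^sup>+ n. f n \<partial>geometric_pmf (1 / 2))"
proof -
  have "(\<integral>\<^sup>+ x. f (fst (strand_of x)) \<partial>curve t) = (\<integral>\<^sup>+ s. f (fst s) \<partial>strand_pmf)"
    unfolding curve_def by (subst nn_integral_distr) auto
  then show ?thesis by (simp flip: map_pmf_fst_strand_pmf)
qed

text \<open>Under \<open>curve t\<close> the time coordinate is almost surely \<open>t\<close>.
  Distinctness matters because compatibility concerns a set of measures, and multi-couplings are
  indexed by its members.\<close>

lemma curve_inj:
  assumes "curve s = curve t" shows "s = t"
proof -
  interpret prob_space "curve s" by (rule prob_space_curve)
  have "AE x in curve s. s = t"
    using AE_curve_time_of[of s] AE_curve_time_of[of t] unfolding assms[symmetric]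
    by eventually_elim simp
  then show ?thesis by simp
qed

lemma curve_moment:
  assumes "0 \<le> p" shows "curve t \<in> prob_moment p helix"
proof -
  interpret prob_space "curve t" by (rule prob_space_curve)
  \<comment> \<open>The base point has the same time \<open>t\<close>, so its distance to the values
    of the map is a mere gap and at most 1.\<close>
  define a where "a = point t (turn (\<lambda>_. 0) (0, 0))"
  have "(\<integral>\<^sup>+ x. ennreal (helix_dist a x powr p) \<partial>curve t) \<le>
      (\<integral>\<^sup>+ s. ennreal (helix_dist a (point t (turn (\<lambda>_. 0) s)) powr p) \<partial>strand_pmf)"
    unfolding curve_def by (rule nn_integral_distr_le) simp
  also have "\<dots> \<le> (\<integral>\<^sup>+ s. 1 \<partial>strand_pmf)"
    using strand_gap_le assms
    by (intro nn_integral_mono) (simp add: a_def helix_dist_def powr_le1 flip: ennreal_1)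
  also have "\<dots> < \<infinity>" by simp
  finally have "(\<integral>\<^sup>+ x. ennreal (mdist helix a x powr p) \<partial>curve t) < \<infinity>" by simp
  moreover have "a \<in> mspace helix" by (simp add: a_def)
  ultimately show ?thesis
    using prob_space_curve by (auto simp: prob_moment_def borel_prob_def)
qed


section \<open>Cost of the nearest rotation\<close>

text \<open>The distance from the angle \<open>winding n * u\<close> to the multiples of
  \<open>1 / strands n\<close>; \<open>min_gap_le\<close> and \<open>strand_gap_nearest\<close> show
  it to be the least gap to any strand.\<close>

definition min_gap :: "real \<Rightarrow> nat \<Rightarrow> real" where
  "min_gap u n = circ (of_int (strands n) * (of_int (winding n) * u)) / of_int (strands n)"

lemma min_gap_nonneg: "0 \<le> min_gap u n"
  using strands_pos[of n] by (simp add: min_gap_def)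

lemma min_gap_le: "min_gap u (fst a) \<le> strand_gap u a b"
proof (cases "fst a = fst b")
  case True
  then show ?thesis
    using circ_shift_ge[OF strands_pos] by (simp add: strand_gap_def min_gap_def del: of_int_diff)
next
  case False
  have "1 \<le> real_of_int (strands (fst a))" using strands_pos[of "fst a"] by linarith
  then have "circ x / of_int (strands (fst a)) \<le> 1" for x
    using circ_le_half[of x] by (simp add: divide_le_eq_1)
  then show ?thesis using False by (simp add: strand_gap_def min_gap_def)
qed

definition nearest :: "real \<Rightarrow> nat \<Rightarrow> int" where
  "nearest u n = round (of_int (strands n) * (of_int (winding n) * u) :: real)"

text \<open>The reduced indices differ by \<open>- nearest u n\<close> up to a multiple of
  \<open>strands n\<close>, which is the congruence under which \<open>circ_shift_le\<close> attains
  the bound.\<close>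

lemma strand_gap_nearest:
  "strand_gap u (turn (\<lambda>_. 0) s) (turn (nearest u) s) = min_gap u (fst s)"
proof (rule antisym)
  define k i where "k = strands (fst s)" and "i = snd s"
  have "i mod k - (i + nearest u (fst s)) mod k + nearest u (fst s) =
      k * ((i + nearest u (fst s)) div k - i div k)"
    by (simp add: minus_mult_div_eq_mod[symmetric] algebra_simps)
  then have "k dvd i mod k - (i + nearest u (fst s)) mod k + nearest u (fst s)"
    by (metis dvd_triv_left)
  then have "circ (of_int (winding (fst s)) * u + of_int (i mod k - (i + nearest u (fst s)) mod k) / of_int k)
      \<le> circ (of_int k * (of_int (winding (fst s)) * u)) / of_int k"
    by (intro circ_shift_le) (simp_all add: k_def strands_pos nearest_def)
  then show "strand_gap u (turn (\<lambda>_. 0) s) (turn (nearest u) s) \<le> min_gap u (fst s)"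
    by (simp add: strand_gap_def min_gap_def turn_def k_def i_def del: of_int_diff)
qed (use min_gap_le[of u "turn (\<lambda>_. 0) s"] in simp)

text \<open>Since \<^const>\<open>strands\<close> is the cube of \<^const>\<open>winding\<close>, the minimal gap is Hoelder
  continuous of exponent \<open>3 / 4\<close> uniformly in the block.\<close>

lemma min_gap_power_le: "min_gap u n ^ 4 \<le> \<bar>u\<bar> ^ 3"
proof -
  define f N where "f = min_gap u n" and "N = real_of_int (winding n)"
  have N: "1 \<le> N" using winding_ge[of n] by (simp add: N_def)
  have k: "real_of_int (strands n) = N ^ 3" by (simp add: strands_def N_def)
  have f0: "0 \<le> f" unfolding f_def by (rule min_gap_nonneg)
  have "circ (N ^ 3 * (N * u)) \<le> N ^ 3 * (N * \<bar>u\<bar>)"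
    using circ_le_abs[of "N ^ 3 * (N * u)"] N by (simp add: abs_mult)
  then have f1: "f \<le> N * \<bar>u\<bar>"
    using N by (simp add: f_def min_gap_def k flip: N_def) (simp add: divide_simps mult.commute)
  have "circ (N ^ 3 * (N * u)) \<le> 1" using circ_le_half[of "N ^ 3 * (N * u)"] by linarith
  then have f2: "f \<le> 1 / N ^ 3"
    using N by (simp add: f_def min_gap_def k divide_right_mono flip: N_def)
  \<comment> \<open>Three factors are bounded by the speed and one by the spacing; the powers of
    \<open>N\<close> then cancel.\<close>
  have "f ^ 4 = f ^ 3 * f" by (simp add: eval_nat_numeral)
  also have "\<dots> \<le> (N * \<bar>u\<bar>) ^ 3 * (1 / N ^ 3)"
    using f0 f1 f2 N by (intro mult_mono power_mono) auto
  also have "\<dots> = \<bar>u\<bar> ^ 3" using N by (simp add: power_mult_distrib)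
  finally show ?thesis by (simp add: f_def)
qed

definition near_cost :: "real \<Rightarrow> nat \<Rightarrow> real" where
  "near_cost u n = (\<bar>u\<bar> + min_gap u n) ^ 4"

lemma power4_add_le: "(a + b) ^ 4 \<le> 8 * (a ^ 4 + b ^ 4)" for a b :: real
proof -
  have sq: "(x + y)\<^sup>2 \<le> 2 * (x\<^sup>2 + y\<^sup>2)" for x y :: real
    using zero_le_power2[of "x - y"] by (simp add: power2_eq_square algebra_simps)
  have "(a + b) ^ 4 = ((a + b)\<^sup>2)\<^sup>2" by simp
  also have "\<dots> \<le> (2 * (a\<^sup>2 + b\<^sup>2))\<^sup>2" by (intro power_mono sq) auto
  also have "\<dots> = 4 * (a\<^sup>2 + b\<^sup>2)\<^sup>2" by (simp only: power_mult_distrib) simp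
  also have "\<dots> \<le> 4 * (2 * ((a\<^sup>2)\<^sup>2 + (b\<^sup>2)\<^sup>2))" by (intro mult_left_mono sq) simp
  finally show ?thesis by simp
qed

lemma near_cost_le:
  assumes "\<bar>u\<bar> \<le> 1" shows "near_cost u n \<le> 16 * \<bar>u\<bar> ^ 3"
proof -
  have "\<bar>u\<bar> ^ 4 \<le> \<bar>u\<bar> ^ 3" using assms by (intro power_decreasing) auto
  then show ?thesis
    using power4_add_le[of "\<bar>u\<bar>" "min_gap u n"] min_gap_power_le[of u n] by (simp add: near_cost_def)
qed

definition nearest_coupling :: "real \<Rightarrow> real \<Rightarrow> ((nat \<Rightarrow> real) \<times> (nat \<Rightarrow> real)) measure" where
  "nearest_coupling s t = distr strand_pmf (borel_metric helix \<Otimes>\<^sub>M borel_metric helix)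
     (\<lambda>a. (point s (turn (\<lambda>_. 0) a), point t (turn (nearest (s - t)) a)))"

text \<open>The second marginal is right because a rotation by block-dependent amounts preserves
  \<open>strand_pmf\<close>.\<close>

lemma nearest_coupling: "nearest_coupling s t \<in> couplings helix (curve s) (curve t)"
proof -
  have "distr (nearest_coupling s t) (borel_metric helix) snd =
      distr strand_pmf (borel_metric helix) (\<lambda>a. point t (turn (\<lambda>_. 0) (turn (nearest (s - t)) a)))"
    unfolding nearest_coupling_def
    by (subst distr_distr[OF measurable_snd measurable_pmf_point_pair]) (simp add: comp_def)
  also have "\<dots> = curve t" unfolding curve_def by (rule distr_turn) simp
  moreover have "distr (nearest_coupling s t) (borel_metric helix) fst = curve s"
    unfolding nearest_coupling_def curve_def
    by (subst distr_distr[OF measurable_fst measurable_pmf_point_pair]) (simp add: comp_def)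
  moreover have "prob_space (nearest_coupling s t)"
    unfolding nearest_coupling_def
    by (rule measure_pmf.prob_space_distr[OF measurable_pmf_point_pair])
  ultimately show ?thesis by (simp add: couplings_def nearest_coupling_def)
qed

lemma transport_cost_nearest_coupling:
  "transport_cost 4 helix (nearest_coupling s t) \<le>
     (\<integral>\<^sup>+ n. ennreal (near_cost (s - t) n) \<partial>geometric_pmf (1 / 2))"
proof -
  have "transport_cost 4 helix (nearest_coupling s t) \<le> (\<integral>\<^sup>+ a. ennreal (helix_dist
      (point s (turn (\<lambda>_. 0) a)) (point t (turn (nearest (s - t)) a)) powr 4) \<partial>strand_pmf)"
    unfolding transport_cost_def nearest_coupling_def
    by (rule order_trans[OF nn_integral_distr_le[OF measurable_pmf_point_pair]]) auto
  also have "\<dots> = (\<integral>\<^sup>+ a. ennreal (near_cost (s - t) (fst a)) \<partial>strand_pmf)"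
    by (simp add: helix_dist_def strand_gap_nearest near_cost_def min_gap_nonneg)
  finally show ?thesis by (simp flip: map_pmf_fst_strand_pmf)
qed

lemma wasserstein_curve_le:
  assumes "\<bar>s - t\<bar> \<le> 1"
  shows "wasserstein 4 helix (curve s) (curve t) powr 4 \<le> 16 * \<bar>s - t\<bar> ^ 3"
proof -
  have "(INF q \<in> couplings helix (curve s) (curve t). transport_cost 4 helix q) \<le>
      transport_cost 4 helix (nearest_coupling s t)"
    by (rule INF_lower[OF nearest_coupling])
  also note transport_cost_nearest_coupling
  also have "(\<integral>\<^sup>+ n. ennreal (near_cost (s - t) n) \<partial>geometric_pmf (1 / 2)) \<le>
      (\<integral>\<^sup>+ n. ennreal (16 * \<bar>s - t\<bar> ^ 3) \<partial>geometric_pmf (1 / 2))"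
    by (intro nn_integral_mono ennreal_leI near_cost_le assms)
  also have "\<dots> = ennreal (16 * \<bar>s - t\<bar> ^ 3)" by simp
  finally have "enn2real (INF q \<in> couplings helix (curve s) (curve t). transport_cost 4 helix q) \<le>
      16 * \<bar>s - t\<bar> ^ 3"
    by (intro enn2real_leI) auto
  then show ?thesis by (simp add: wasserstein_def powr_powr)
qed


section \<open>Regularity and incompatibility of the curve\<close>

lemma wasserstein_nonneg: "0 \<le> wasserstein p m \<mu> \<nu>"
  by (simp add: wasserstein_def)

text \<open>The kernel has exponent -3, which the bound 16 \<bar>s - t\<bar>^3 on the fourth power
  of the distance cancels: the integrand is at most 16 on the unit square. The same bound gives
  continuity.\<close>

lemma sobolev_path_curve:
  "sobolev_path (prob_moment 4 helix) (wasserstein 4 helix) (1 / 2) 4 1 curve"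
  unfolding sobolev_path_def
proof (intro conjI ballI)
  let ?W = "\<lambda>s t. wasserstein 4 helix (curve s) (curve t)"
  have W: "?W s t ^ 4 \<le> 16 * \<bar>s - t\<bar> ^ 3" if "s \<in> {0..1}" "t \<in> {0..1}" for s t
  proof -
    have "\<bar>s - t\<bar> \<le> 1" using that by auto
    from wasserstein_curve_le[OF this] show ?thesis by (simp add: wasserstein_nonneg)
  qed
  show "curve t \<in> prob_moment 4 helix" for t
    by (rule curve_moment) simp
  show "((\<lambda>s. ?W s t) \<longlongrightarrow> 0) (at t within {0..1})" if t: "t \<in> {0..1}" for t
  proof (rule tendsto_sandwich[OF _ _ tendsto_const])
    show "eventually (\<lambda>s. ?W s t \<le> root 4 (16 * \<bar>s - t\<bar> ^ 3)) (at t within {0..1})"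
      unfolding eventually_at_filter
    proof (rule always_eventually, intro allI impI)
      fix s :: real assume s: "s \<in> {0..1}"
      have "?W s t = root 4 (?W s t ^ 4)"
        by (rule real_root_power_cancel[symmetric]) (simp_all add: wasserstein_nonneg)
      also have "\<dots> \<le> root 4 (16 * \<bar>s - t\<bar> ^ 3)"
        using W[OF s t] by (intro real_root_le_mono) simp_all
      finally show "?W s t \<le> root 4 (16 * \<bar>s - t\<bar> ^ 3)" .
    qed
    have "((\<lambda>s. root 4 (16 * \<bar>s - t\<bar> ^ 3)) \<longlongrightarrow> root 4 (16 * \<bar>t - t\<bar> ^ 3)) (at t within {0..1})"
      by (intro tendsto_intros)
    then show "((\<lambda>s. root 4 (16 * \<bar>s - t\<bar> ^ 3)) \<longlongrightarrow> 0) (at t within {0..1})" by simp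
  qed (simp add: wasserstein_nonneg)
  have bound: "?W s t powr 4 * \<bar>t - s\<bar> powr (- 1 - 1 / 2 * 4) \<le> 16"
    if st: "s \<in> {0..1}" "t \<in> {0..1}" for s t
  \<comment> \<open>The quotient form needs \<open>s \<noteq> t\<close>; on the diagonal the kernel
    is \<open>0 powr (-3)\<close>, which is 0.\<close>
  proof (cases "s = t")
    case False
    have "?W s t powr 4 * \<bar>t - s\<bar> powr (- 1 - 1 / 2 * 4) = ?W s t ^ 4 / \<bar>s - t\<bar> ^ 3"
      using False powr_minus_divide[of "\<bar>t - s\<bar>" 3]
      by (simp add: wasserstein_nonneg abs_minus_commute)
    also have "\<dots> \<le> 16" using W[OF st] False by (simp add: divide_le_eq)
    finally show ?thesis .
  qed simp
  have "(\<integral>\<^sup>+ z \<in> {0..1} \<times> {0..1}. (case z of (s, t) \<Rightarrow>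
      ennreal (?W s t powr 4 * \<bar>t - s\<bar> powr (- 1 - 1 / 2 * 4))) \<partial>(lborel \<Otimes>\<^sub>M lborel)) \<le>
    (\<integral>\<^sup>+ z. 16 * indicator ({0..1::real} \<times> {0..1::real}) z \<partial>(lborel \<Otimes>\<^sub>M lborel))"
  proof (intro nn_integral_mono)
    fix z :: "real \<times> real"
    obtain s t where z: "z = (s, t)" by (cases z)
    show "(case z of (s, t) \<Rightarrow> ennreal (?W s t powr 4 * \<bar>t - s\<bar> powr (- 1 - 1 / 2 * 4))) *
        indicator ({0..1} \<times> {0..1}) z \<le> 16 * indicator ({0..1} \<times> {0..1}) z"
      using ennreal_leI[OF bound[of s t]] by (auto simp: z indicator_def simp del: ennreal_numeral simp flip: ennreal_numeral)
  qed
  also have "\<dots> = 16 * emeasure (lborel \<Otimes>\<^sub>M lborel) ({0..1::real} \<times> {0..1::real})"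
    by (rule nn_integral_cmult_indicator) simp
  also have "\<dots> = 16" by (subst lborel.emeasure_pair_measure_Times) auto
  finally show "sobolev_seminorm (wasserstein 4 helix) (1 / 2) 4 1 curve < \<infinity>"
    by (auto simp: sobolev_seminorm_def enn_powr_def top_unique)
qed

text \<open>Almost surely a pair costs at least \<open>near_cost\<close> of the block of its first
  point. The mean of this bound is determined by the first marginal, hence the same for all
  couplings, and \<open>nearest_coupling\<close> costs no more. So an optimal coupling gives no mass
  to pairs whose gap exceeds the minimum by \<open>d\<close>.\<close>

lemma optimal_coupling_avoids_gap:
  assumes q: "q \<in> optimal_couplings 4 helix (curve s) (curve t)" and d: "0 < d"
    and R: "\<And>a b. a \<in> strand_set \<Longrightarrow> b \<in> strand_set \<Longrightarrow> R a b \<Longrightarrow>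
              min_gap (s - t) (fst a) + d \<le> strand_gap (s - t) a b"
  shows "AE z in q. \<not> R (strand_of (fst z)) (strand_of (snd z))"
proof -
  let ?B = "borel_metric helix"
  let ?F = "\<lambda>z. ennreal (near_cost (s - t) (fst (strand_of (fst z))))"
  define A where "A = {z \<in> space (?B \<Otimes>\<^sub>M ?B). R (strand_of (fst z)) (strand_of (snd z))}"
  have "prob_space q" and sets: "sets q = sets (?B \<Otimes>\<^sub>M ?B)"
    and fst: "distr q ?B fst = curve s" and snd: "distr q ?B snd = curve t"
    and opt: "transport_cost 4 helix q \<le> transport_cost 4 helix (nearest_coupling s t)"
    using q nearest_coupling by (auto simp: optimal_couplings_def couplings_def)
  interpret prob_space q by fact
  note [measurable_cong] = sets
  have fst_m [measurable]: "fst \<in> q \<rightarrow>\<^sub>M ?B" and snd_m [measurable]: "snd \<in> q \<rightarrow>\<^sub>M ?B"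
    by measurable
  have pair: "(\<lambda>z. (strand_of (fst z), strand_of (snd z))) \<in> q \<rightarrow>\<^sub>M count_space UNIV"
  proof -
    have "(\<lambda>z. (strand_of (fst z), strand_of (snd z))) \<in> q \<rightarrow>\<^sub>M count_space UNIV \<Otimes>\<^sub>M count_space UNIV"
      by measurable
    then show ?thesis by (simp add: pair_measure_countable)
  qed
  have sp: "space q = space (?B \<Otimes>\<^sub>M ?B)" by (rule sets_eq_imp_space_eq[OF sets])
  have "A = (\<lambda>z. (strand_of (fst z), strand_of (snd z))) -` {(a, b). R a b} \<inter> space q"
    by (auto simp: A_def sp)
  then have A [measurable]: "A \<in> sets q" using measurable_sets[OF pair] by simp
  have F: "?F \<in> borel_measurable q"
    by (intro measurable_compose[OF fst_m measurable_compose[OF measurable_strand_of]]) simp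
  have intF: "(\<integral>\<^sup>+ z. ?F z \<partial>q) = (\<integral>\<^sup>+ n. ennreal (near_cost (s - t) n) \<partial>geometric_pmf (1 / 2))"
  proof -
    have "(\<integral>\<^sup>+ z. ?F z \<partial>q) = (\<integral>\<^sup>+ x. ennreal (near_cost (s - t) (fst (strand_of x))) \<partial>distr q ?B fst)"
      by (rule nn_integral_distr[symmetric, OF fst_m]) (simp add: measurable_block)
    then show ?thesis using nn_integral_curve unfolding fst by simp
  qed
  have "AE z in q. time_of (fst z) = s" "AE z in q. time_of (snd z) = t"
    using AE_distrD[OF fst_m] AE_distrD[OF snd_m] AE_curve_time_of unfolding fst snd by blast+
  then have lower: "AE z in q. ?F z + ennreal (d ^ 4) * indicator A z \<le>
      (case z of (x, y) \<Rightarrow> ennreal (mdist helix x y powr 4))"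
    using AE_space
  proof eventually_elim
    case (elim z)
    obtain x y where z: "z = (x, y)" by (cases z)
    define a b where "a = strand_of x" and "b = strand_of y"
    have mem: "a \<in> strand_set" "b \<in> strand_set"
      using elim(3) by (auto simp: z sp space_pair_measure a_def b_def strand_of_in)
    have dist: "helix_dist x y = \<bar>s - t\<bar> + strand_gap (s - t) a b"
      using elim by (simp add: z helix_dist_def a_def b_def)
    \<comment> \<open>\<open>e\<close> handles pairs inside and outside \<open>A\<close> at once;
      superadditivity of the fourth power turns an excess \<open>d\<close> of the gap into an excess
      \<open>d ^ 4\<close> of the cost.\<close>
    define e where "e = (if z \<in> A then d else 0)"
    have e: "0 \<le> e" using d by (simp add: e_def)
    have "min_gap (s - t) (fst a) + e \<le> strand_gap (s - t) a b"
      using R[OF mem] min_gap_le by (auto simp: e_def A_def z a_def b_def)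
    then have "(\<bar>s - t\<bar> + min_gap (s - t) (fst a) + e) ^ 4 \<le> helix_dist x y ^ 4"
      using e min_gap_nonneg[of "s - t" "fst a"] unfolding dist by (intro power_mono) auto
    moreover have "u ^ 4 + e ^ 4 \<le> (u + e) ^ 4" if "0 \<le> u" for u
      using that e by (simp add: eval_nat_numeral algebra_simps)
    ultimately have "near_cost (s - t) (fst a) + e ^ 4 \<le> helix_dist x y ^ 4"
      using min_gap_nonneg[of "s - t" "fst a"] unfolding near_cost_def
      by (smt (verit) abs_ge_zero)
    moreover have "?F z + ennreal (d ^ 4) * indicator A z = ennreal (near_cost (s - t) (fst a) + e ^ 4)"
      using d by (auto simp: z a_def e_def near_cost_def indicator_def ennreal_plus)
    ultimately show ?case
      using ennreal_leI by (simp add: z)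
  qed
  have "(\<integral>\<^sup>+ z. ?F z \<partial>q) + ennreal (d ^ 4) * emeasure q A =
      (\<integral>\<^sup>+ z. ?F z + ennreal (d ^ 4) * indicator A z \<partial>q)"
    using F by (subst nn_integral_add) (auto simp: nn_integral_cmult_indicator)
  also have "\<dots> \<le> transport_cost 4 helix q"
    unfolding transport_cost_def using lower by (rule nn_integral_mono_AE)
  also note opt
  also note transport_cost_nearest_coupling
  finally have le: "(\<integral>\<^sup>+ z. ?F z \<partial>q) + ennreal (d ^ 4) * emeasure q A \<le> (\<integral>\<^sup>+ z. ?F z \<partial>q)"
    by (simp add: intF)
  \<comment> \<open>Finiteness of this mean allows it to be cancelled from both sides of
    \<open>le\<close>.\<close>
  have "(\<integral>\<^sup>+ z. ?F z \<partial>q) \<le> (\<integral>\<^sup>+ z. ennreal ((\<bar>s - t\<bar> + 1) ^ 4) \<partial>q)"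
    unfolding near_cost_def
    using order_trans[OF min_gap_le strand_gap_le] min_gap_nonneg
    by (intro nn_integral_mono ennreal_leI power_mono) auto
  also have "\<dots> < \<infinity>" by (simp add: emeasure_space_1 ennreal_mult_less_top)
  finally have "ennreal (d ^ 4) * emeasure q A = 0"
    using le ennreal_add_left_cancel_le[of "\<integral>\<^sup>+ z. ?F z \<partial>q" "ennreal (d ^ 4) * emeasure q A" 0]
    by auto
  then have "emeasure q A = 0" using d by (simp add: ennreal_eq_0_iff)
  then have "A \<in> null_sets q" using A by auto
  then have "AE z in q. z \<notin> A" by (rule AE_not_in)
  then show ?thesis using AE_space by eventually_elim (auto simp: A_def sp)
qed

section \<open>Incompatibility, seen at three times in block 0\<close>

lemma winding_0: "winding 0 = 2" and strands_0: "strands 0 = 8"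
  by (simp_all add: winding_def strands_def)

text \<open>In this time block 0 turns by 1/20, less than half the spacing 1/8, so the own strand is
  nearest. Any other strand of the block is at least 1/8 - 1/20 = 3/40 away, an excess of
  1/40.\<close>

lemma strand_gap_short_step:
  assumes "a \<in> strand_set" "b \<in> strand_set" "fst a = 0" "a \<noteq> b" "\<bar>u\<bar> = 1 / 40"
  shows "min_gap u (fst a) + 1 / 40 \<le> strand_gap u a b"
proof -
  have u: "u = 1 / 40 \<or> u = - (1 / 40)" using assms(5) by linarith
  have m: "min_gap u 0 = 1 / 20"
    using u by (auto simp: min_gap_def winding_0 strands_0 circ_eq_abs)
  show ?thesis
  proof (cases "fst b = 0")
    case True
    have "3 / 40 \<le> circ (2 * u + of_int (snd a - snd b) / 8)"
    proof (rule circ_ge)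
      fix l :: int
      define w where "w = snd a - snd b - 8 * l"
      have "w \<noteq> 0"
        using strand_eqI[OF assms(1,2)] assms True by (auto simp: w_def strands_0)
      then have "1 \<le> w \<or> w \<le> -1" by linarith
      then have w: "1 \<le> real_of_int w \<or> real_of_int w \<le> -1" by linarith
      have "2 * u + of_int (snd a - snd b) / 8 - of_int l = 2 * u + of_int w / 8"
        by (simp add: w_def)
      then show "3 / 40 \<le> \<bar>2 * u + of_int (snd a - snd b) / 8 - of_int l\<bar>"
        using u w by linarith
    qed
    then show ?thesis using True assms(3) m by (simp add: strand_gap_def winding_0 strands_0)
  next
    case False
    then show ?thesis using assms(3) m by (simp add: strand_gap_def)
  qed
qed

text \<open>The turn by 1/10 is more than half the spacing: a neighbouring strand is at gap 1/8 -
  1/10 = 1/40, whereas staying on the strand gives 1/10.\<close>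

lemma strand_gap_long_step:
  "min_gap (- 1 / 20) 0 + 1 / 40 \<le> strand_gap (- 1 / 20) (0, i) (0, i)"
proof -
  have "round (- (4 / 5) :: real) = - 1" by (rule round_unique) auto
  then have "min_gap (- 1 / 20) 0 = 1 / 40"
    by (simp add: min_gap_def winding_0 strands_0 circ_def)
  moreover have "strand_gap (- 1 / 20) (0, i) (0, i) = 1 / 10"
    by (simp add: strand_gap_def winding_0 strands_0 circ_eq_abs)
  ultimately show ?thesis by simp
qed

text \<open>In block 0 the optimal couplings from time 0 to 1/40 and from 1/40 to 1/20 stay on the strand,
  whereas from 0 to 1/20 a neighbouring strand is closer.\<close>

lemma not_compatible_curve: "\<not> compatible 4 helix (curve ` {0..1})"
proof
  assume comp: "compatible 4 helix (curve ` {0..1})"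
  define F where "F = curve ` {0, 1 / 40, 1 / 20}"
  have "finite F \<and> F \<subseteq> curve ` {0..1}" by (auto simp: F_def)
  with comp have "\<exists>Q \<in> multi_couplings helix F. \<forall>\<mu> \<in> F. \<forall>\<nu> \<in> F. \<mu> \<noteq> \<nu> \<longrightarrow>
      distr Q (borel_metric helix \<Otimes>\<^sub>M borel_metric helix) (\<lambda>\<omega>. (\<omega> \<mu>, \<omega> \<nu>))
        \<in> optimal_couplings 4 helix \<mu> \<nu>"
    unfolding compatible_def by (elim allE impE)
  then obtain Q where Q: "Q \<in> multi_couplings helix F"
    and opt: "\<And>\<mu> \<nu>. \<mu> \<in> F \<Longrightarrow> \<nu> \<in> F \<Longrightarrow> \<mu> \<noteq> \<nu> \<Longrightarrow>
      distr Q (borel_metric helix \<Otimes>\<^sub>M borel_metric helix) (\<lambda>\<omega>. (\<omega> \<mu>, \<omega> \<nu>))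
        \<in> optimal_couplings 4 helix \<mu> \<nu>"
    by (elim bexE) simp
  let ?B = "borel_metric helix"
  define s0 s1 s2 where "s0 = (\<lambda>\<omega>. strand_of (\<omega> (curve 0)))"
    and "s1 = (\<lambda>\<omega>. strand_of (\<omega> (curve (1 / 40))))"
    and "s2 = (\<lambda>\<omega>. strand_of (\<omega> (curve (1 / 20))))"
  have "prob_space Q" and sets: "sets Q = sets (Pi\<^sub>M F (\<lambda>_. ?B))"
    and marg: "\<And>\<mu>. \<mu> \<in> F \<Longrightarrow> distr Q ?B (\<lambda>\<omega>. \<omega> \<mu>) = \<mu>"
    using Q by (auto simp: multi_couplings_def)
  interpret prob_space Q by fact
  note [measurable_cong] = sets
  have eval: "(\<lambda>\<omega>. \<omega> \<mu>) \<in> Q \<rightarrow>\<^sub>M ?B" if "\<mu> \<in> F" for \<mu>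
    using that by measurable
  \<comment> \<open>Optimality of a two-dimensional marginal of \<open>Q\<close> makes any relation
    with excess gap a null event; the margin 1/40 serves all three pairs of times.\<close>
  have avoid: "AE \<omega> in Q. \<not> R (strand_of (\<omega> (curve s))) (strand_of (\<omega> (curve t)))"
    if "curve s \<in> F" "curve t \<in> F" "s \<noteq> t" and
      "\<And>a b. a \<in> strand_set \<Longrightarrow> b \<in> strand_set \<Longrightarrow> R a b \<Longrightarrow>
         min_gap (s - t) (fst a) + 1 / 40 \<le> strand_gap (s - t) a b" for R s t
  proof -
    have pair: "(\<lambda>\<omega>. (\<omega> (curve s), \<omega> (curve t))) \<in> Q \<rightarrow>\<^sub>M ?B \<Otimes>\<^sub>M ?B"
      using eval[OF that(1)] eval[OF that(2)] by measurable
    have "curve s \<noteq> curve t" using curve_inj that(3) by blast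
    from optimal_coupling_avoids_gap[OF opt[OF that(1,2) this], of "1 / 40" R]
    have "AE z in distr Q (?B \<Otimes>\<^sub>M ?B) (\<lambda>\<omega>. (\<omega> (curve s), \<omega> (curve t))).
        \<not> R (strand_of (fst z)) (strand_of (snd z))"
      using that(4) by simp
    from AE_distrD[OF pair this] show ?thesis by simp
  qed
  have "AE \<omega> in Q. \<not> (fst (s0 \<omega>) = 0 \<and> s0 \<omega> \<noteq> s1 \<omega>)"
    unfolding s0_def s1_def
  proof (rule avoid)
    fix a b assume "a \<in> strand_set" "b \<in> strand_set" "fst a = 0 \<and> a \<noteq> b"
    then show "min_gap (0 - 1 / 40) (fst a) + 1 / 40 \<le> strand_gap (0 - 1 / 40) a b"
      by (intro strand_gap_short_step) simp_all
  qed (simp_all add: F_def)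
  moreover have "AE \<omega> in Q. \<not> (fst (s1 \<omega>) = 0 \<and> s1 \<omega> \<noteq> s2 \<omega>)"
    unfolding s1_def s2_def
  proof (rule avoid)
    fix a b assume "a \<in> strand_set" "b \<in> strand_set" "fst a = 0 \<and> a \<noteq> b"
    then show "min_gap (1 / 40 - 1 / 20) (fst a) + 1 / 40 \<le> strand_gap (1 / 40 - 1 / 20) a b"
      by (intro strand_gap_short_step) simp_all
  qed (simp_all add: F_def)
  moreover have "AE \<omega> in Q. \<not> (fst (s0 \<omega>) = 0 \<and> s0 \<omega> = s2 \<omega>)"
    unfolding s0_def s2_def
  proof (rule avoid)
    fix a b :: "nat \<times> int" assume "fst a = 0 \<and> a = b"
    then show "min_gap (0 - 1 / 20) (fst a) + 1 / 40 \<le> strand_gap (0 - 1 / 20) a b"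
      using strand_gap_long_step[of "snd a"] by (cases a) auto
  qed (simp_all add: F_def)
  \<comment> \<open>On block 0 the relations \<open>s0 = s1\<close>, \<open>s1 = s2\<close> and
    \<open>s0 \<noteq> s2\<close> contradict each other, so block 0 would have probability 0; its
    mass is 1/2.\<close>
  ultimately have "AE \<omega> in Q. fst (s0 \<omega>) \<noteq> 0" by eventually_elim auto
  then have "(\<integral>\<^sup>+ \<omega>. indicator {0} (fst (s0 \<omega>)) \<partial>Q) = (\<integral>\<^sup>+ \<omega>. 0 \<partial>Q)"
    by (intro nn_integral_cong_AE) (auto elim!: eventually_mono)
  also have "(\<integral>\<^sup>+ \<omega>. indicator {0} (fst (s0 \<omega>)) \<partial>Q) =
      (\<integral>\<^sup>+ x. indicator {0} (fst (strand_of x)) \<partial>distr Q ?B (\<lambda>\<omega>. \<omega> (curve 0)))"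
    unfolding s0_def
    by (rule nn_integral_distr[symmetric, OF eval])
      (simp_all add: F_def measurable_block)
  also have "\<dots> = (\<integral>\<^sup>+ n. indicator {0} n \<partial>geometric_pmf (1 / 2))"
    using marg nn_integral_curve by (simp add: F_def)
  also have "\<dots> = ennreal (1 / 2)" by (simp add: emeasure_pmf_single)
  finally show False by simp
qed


section \<open>The unique lift\<close>

text \<open>The restriction makes the path \<open>undefined\<close> outside the interval, as members
  of \<open>path_space\<close> are.\<close>

definition strand_path :: "nat \<times> int \<Rightarrow> real \<Rightarrow> nat \<Rightarrow> real" where
  "strand_path a = restrict (\<lambda>t. point t a) {0..1}"

lemma strand_path_in:
  assumes a: "a \<in> strand_set"
  shows "strand_path a \<in> mspace (path_space 1 helix)"
proof -
  define L where "L = 1 + real_of_int (winding (fst a))"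
  have L: "0 < L" using winding_ge[of "fst a"] by (simp add: L_def)
  have "\<exists>U. openin (top_of_set {0..1}) U \<and> t \<in> U \<and>
      (\<forall>s\<in>U. strand_path a s \<in> helix.mball (strand_path a t) e)"
    if t: "t \<in> {0..1}" and e: "0 < e" for t e
  proof (intro exI conjI ballI)
    show "openin (top_of_set {0..1}) ({0..1} \<inter> ball t (e / L))"
      by (rule openin_open_Int) simp
    show "t \<in> {0..1} \<inter> ball t (e / L)" using t e L by simp
    fix s assume s: "s \<in> {0..1} \<inter> ball t (e / L)"
    then have "L * \<bar>t - s\<bar> < e" using L by (simp add: dist_real_def field_simps)
    then have "helix_dist (point t a) (point s a) < e"
      using helix_dist_same_strand_le[of t a s] by (simp add: L_def)
    then show "strand_path a s \<in> helix.mball (strand_path a t) e"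
      using s t a by (simp add: strand_path_def)
  qed
  then have cont: "continuous_map (top_of_set {0..1}) (mtopology_of helix) (strand_path a)"
    by (simp add: helix.continuous_map_to_metric)
  \<comment> \<open>Members of \<open>cfunspace\<close> have to be bounded, which follows from
    compactness of the interval.\<close>
  have "helix.mbounded (strand_path a ` {0..1})"
    using image_compactin[OF _ cont, of "{0..1}"]
    by (intro helix.compactin_imp_mbounded) (simp add: compactin_subtopology)
  then show ?thesis
    using a cont by (auto simp: path_space_def strand_path_def)
qed

lemma measurable_path_of_strand:
  "(\<lambda>x. strand_path (strand_of x)) \<in> borel_metric helix \<rightarrow>\<^sub>M borel_metric (path_space 1 helix)"
  by (rule measurable_compose[OF measurable_strand_of_strand_set]) (simp add: strand_path_in)

text \<open>A path that visits its own time on the rationals does so always, by continuity, and it cannot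
  change strand because strands are open and closed.\<close>

lemma path_eq_strand_path:
  assumes \<gamma>: "\<gamma> \<in> mspace (path_space 1 helix)"
    and rat: "\<And>t. t \<in> \<rat> \<inter> {0..1} \<Longrightarrow> time_of (\<gamma> t) = t"
  shows "\<gamma> = strand_path (strand_of (\<gamma> 0))"
proof
  fix t
  have cont: "continuous_map (top_of_set {0..1}) (mtopology_of helix) \<gamma>"
    and mem: "\<And>t. t \<in> {0..1} \<Longrightarrow> \<gamma> t \<in> helix_set" and ext: "\<gamma> \<in> extensional {0..1}"
    using \<gamma> by (auto simp: path_space_def)
  \<comment> \<open>Density of the rationals is applied on the open interval; taking closures
    supplies the endpoints.\<close>
  have "{0<..<1::real} \<subseteq> closure ({0<..<1} \<inter> \<rat>)"
    using open_Int_closure_subset[of "{0<..<1::real}" \<rat>] by (simp add: Rats_closure_real)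
  also have "\<dots> \<subseteq> closure (\<rat> \<inter> {0..1})" by (intro closure_mono) auto
  finally have "closure {0<..<1::real} \<subseteq> closure (\<rat> \<inter> {0..1})"
    by (rule closure_minimal) simp
  moreover have "closure (\<rat> \<inter> {0..1::real}) \<subseteq> {0..1}" by (rule closure_minimal) auto
  ultimately have cl: "closure (\<rat> \<inter> {0..1::real}) = {0..1}" by simp
  have "continuous_on {0..1} (\<lambda>t. time_of (\<gamma> t) - t)"
    using continuous_map_compose[OF cont continuous_map_time_of]
    by (intro continuous_intros) (simp add: comp_def)
  then have time: "time_of (\<gamma> t) = t" if "t \<in> {0..1}" for t
    using continuous_constant_on_closure[of "\<rat> \<inter> {0..1}" "\<lambda>t. time_of (\<gamma> t) - t" 0 t] rat that
    by (simp add: cl)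
  have op: "openin (top_of_set {0..1}) {t \<in> {0..1}. P (strand_of (\<gamma> t))}" for P
  proof -
    have "{t \<in> {0..1}. P (strand_of (\<gamma> t))} =
        {t \<in> topspace (top_of_set {0..1}). \<gamma> t \<in> {x \<in> helix_set. P (strand_of x)}}"
      using mem by auto
    then show ?thesis
      using openin_continuous_map_preimage[OF cont openin_strand_of, of P] by simp
  qed
  let ?S = "{t \<in> {0..1}. strand_of (\<gamma> t) = strand_of (\<gamma> 0)}"
  have "{0..1} - ?S = {t \<in> {0..1}. strand_of (\<gamma> t) \<noteq> strand_of (\<gamma> 0)}" by auto
  then have "openin (top_of_set {0..1}) ({0..1} - ?S)"
    using op[of "\<lambda>a. a \<noteq> strand_of (\<gamma> 0)"] by (simp only:)
  then have "closedin (top_of_set {0..1}) ?S"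
    unfolding closedin_def topspace_euclidean_subtopology by (intro conjI) blast
  moreover have "openin (top_of_set {0..1}) ?S" by (rule op)
  moreover have "0 \<in> ?S" by simp
  ultimately have S: "?S = {0..1}"
    using connected_Icc[of 0 "1::real"] unfolding connected_clopen by (metis (no_types, lifting) empty_iff)
  show "\<gamma> t = strand_path (strand_of (\<gamma> 0)) t"
  proof (cases "t \<in> {0..1}")
    case True
    then have "strand_of (\<gamma> t) = strand_of (\<gamma> 0)" using S by blast
    then show ?thesis
      using True helix_set_eq[OF mem[OF True]] time[OF True] by (simp add: strand_path_def)
  next
    case False
    then show ?thesis using ext by (auto simp: strand_path_def extensional_def)
  qed
qed

text \<open>Each marginal fixes the time coordinate outside a null set that depends on
  \<open>t\<close>. Countably many rational times share a single null set, and off it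
  \<open>path_eq_strand_path\<close> applies.\<close>

lemma AE_lift_eq_strand_path:
  assumes "\<pi> \<in> lifts 1 helix curve"
  shows "AE \<gamma> in \<pi>. \<gamma> = strand_path (strand_of (\<gamma> 0))"
proof -
  have sets: "sets \<pi> = sets (borel_metric (path_space 1 helix))"
    and marg: "\<And>t. t \<in> {0..1} \<Longrightarrow> distr \<pi> (borel_metric helix) (\<lambda>\<gamma>. \<gamma> t) = curve t"
    using assms by (auto simp: lifts_def borel_prob_def)
  have "AE \<gamma> in \<pi>. time_of (\<gamma> t) = t" if t: "t \<in> {0..1}" for t
  proof -
    have "(\<lambda>\<gamma>. \<gamma> t) \<in> \<pi> \<rightarrow>\<^sub>M borel_metric helix"
      using eval_path_space_measurable[OF t, of helix] by (simp add: measurable_cong_sets[OF sets refl])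
    from AE_distrD[OF this, of "\<lambda>x. time_of x = t"] show ?thesis
      using AE_curve_time_of[of t] unfolding marg[OF t] by simp
  qed
  then have "AE \<gamma> in \<pi>. \<forall>t \<in> \<rat> \<inter> {0..1}. time_of (\<gamma> t) = t"
    by (subst AE_ball_countable) (auto simp: countable_rat)
  then show ?thesis
    using AE_space
  proof eventually_elim
    case (elim \<gamma>)
    then show ?case
      using sets_eq_imp_space_eq[OF sets] by (intro path_eq_strand_path) auto
  qed
qed

definition curve_lift :: "(real \<Rightarrow> nat \<Rightarrow> real) measure" where
  "curve_lift = distr (curve 0) (borel_metric (path_space 1 helix)) (\<lambda>x. strand_path (strand_of x))"

lemma measurable_curve_lift:
  "(\<lambda>x. strand_path (strand_of x)) \<in> curve 0 \<rightarrow>\<^sub>M borel_metric (path_space 1 helix)"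
  using measurable_path_of_strand by (simp add: measurable_cong_sets[OF sets_curve refl])

lemma curve_lift_in: "curve_lift \<in> lifts 1 helix curve"
proof -
  have "distr curve_lift (borel_metric helix) (\<lambda>\<gamma>. \<gamma> t) = curve t" if t: "t \<in> {0..1}" for t
  proof -
    have "distr curve_lift (borel_metric helix) (\<lambda>\<gamma>. \<gamma> t) =
        distr (curve 0) (borel_metric helix) (\<lambda>x. point t (strand_of x))"
      unfolding curve_lift_def
      by (subst distr_distr[OF eval_path_space_measurable[OF t] measurable_curve_lift])
        (use t in \<open>simp add: comp_def strand_path_def\<close>)
    also have "(\<lambda>x. point t (strand_of x)) \<in> borel_metric helix \<rightarrow>\<^sub>M borel_metric helix"
      by (rule measurable_compose[OF measurable_strand_of_strand_set]) simp
    then have "distr (curve 0) (borel_metric helix) (\<lambda>x. point t (strand_of x)) = curve t"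
      unfolding curve_def by (subst distr_distr) (simp_all add: comp_def)
    finally show ?thesis .
  qed
  then show ?thesis
    using prob_space.prob_space_distr[OF prob_space_curve measurable_curve_lift]
    by (simp add: lifts_def borel_prob_def curve_lift_def)
qed

text \<open>Almost every path of a lift is a fixed function of its starting point, so the lift is
  the image of its marginal at time 0, which is prescribed.\<close>

lemma lifts_curve: "lifts 1 helix curve = {curve_lift}"
proof -
  have "\<pi> = curve_lift" if \<pi>: "\<pi> \<in> lifts 1 helix curve" for \<pi>
  proof -
    let ?P = "borel_metric (path_space 1 helix)"
    have sets: "sets \<pi> = sets ?P"
      and marg: "distr \<pi> (borel_metric helix) (\<lambda>\<gamma>. \<gamma> 0) = curve 0"
      using \<pi> by (auto simp: lifts_def borel_prob_def)
    have eval: "(\<lambda>\<gamma>. \<gamma> 0) \<in> \<pi> \<rightarrow>\<^sub>M borel_metric helix"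
      using eval_path_space_measurable[of 0 1 helix] by (simp add: measurable_cong_sets[OF sets refl])
    have "\<pi> = distr \<pi> ?P (\<lambda>\<gamma>. \<gamma>)" by (rule distr_id2[symmetric]) (simp add: sets)
    also have "\<dots> = distr \<pi> ?P (\<lambda>\<gamma>. strand_path (strand_of (\<gamma> 0)))"
      using AE_lift_eq_strand_path[OF \<pi>] measurable_compose[OF eval measurable_path_of_strand]
      by (intro distr_cong_AE) (auto simp: measurable_cong_sets[OF sets refl])
    also have "\<dots> = distr (distr \<pi> (borel_metric helix) (\<lambda>\<gamma>. \<gamma> 0)) ?P (\<lambda>x. strand_path (strand_of x))"
      by (subst distr_distr[OF measurable_path_of_strand eval]) (simp add: comp_def)
    finally show ?thesis by (simp add: marg curve_lift_def)
  qed
  then show ?thesis using curve_lift_in by blast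
qed


section \<open>Energy of the lift\<close>

text \<open>The seminorm carries an outer root; this recovers the double integral from its power,
  the value infinity included.\<close>

lemma enn_powr_inverse:
  assumes "0 < p" shows "enn_powr (enn_powr x (1 / p)) p = x"
  using assms by (cases x) (auto simp: enn_powr_def powr_powr)

text \<open>For \<open>\<bar>s - t\<bar> < 1 / (2 * N)\<close> the strand moves at full speed \<open>N\<close>; this range is sampled on a rectangle.\<close>

lemma strand_path_energy:
  "ennreal (of_int (winding (fst a)) / 512) \<le>
     enn_powr (sobolev_seminorm (mdist helix) (1 / 2) 4 1 (strand_path a)) 4"
proof -
  define N where "N = real_of_int (winding (fst a))"
  have N: "2 \<le> N" using winding_ge[of "fst a"] by (simp add: N_def)
  \<comment> \<open>For time differences \<open>u\<close> between \<open>h\<close> and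
    \<open>3 * h\<close> the angle \<open>N * u\<close> lies between 1/8 and 3/8: bounded away from
    0, and short of the half turn at which \<open>circ\<close> wraps.\<close>
  define h where "h = 1 / (8 * N)"
  have h: "0 < h" "h \<le> 1 / 16" "N * h = 1 / 8"
    using N by (simp_all add: h_def field_simps)
  define A where "A = {0..h} \<times> {2 * h..3 * h}"
  have A: "s \<in> {0..1}" "t \<in> {0..1}" "\<bar>s - t\<bar> = t - s" "h \<le> t - s" "t - s \<le> 3 * h"
    if "(s, t) \<in> A" for s t
    using that h unfolding A_def by auto
  let ?f = "\<lambda>(s, t). ennreal (mdist helix (strand_path a s) (strand_path a t) powr 4 *
      \<bar>t - s\<bar> powr (- 1 - 1 / 2 * 4))"
  have bound: "N ^ 3 / 8 \<le> helix_dist (strand_path a s) (strand_path a t) powr 4 *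
      \<bar>t - s\<bar> powr (- 1 - 1 / 2 * 4)" if st: "(s, t) \<in> A" for s t
  proof -
    define u where "u = t - s"
    have u: "h \<le> u" "u \<le> 3 * h" "\<bar>s - t\<bar> = u" "\<bar>t - s\<bar> = u"
      using A[OF st] by (auto simp: u_def)
    have u0: "0 < u" using u(1) h(1) by linarith
    have Nu: "N * h \<le> N * u" "N * u \<le> N * (3 * h)" using u(1,2) N by simp_all
    then have "N * u \<le> 3 / 8" using h(3) by simp
    moreover have "\<bar>N * (s - t)\<bar> = N * u" using u(3) N by (simp add: abs_mult)
    ultimately have "circ (N * (s - t)) = N * u" by (subst circ_eq_abs) auto
    then have "N * u \<le> helix_dist (strand_path a s) (strand_path a t)"
      using A[OF st] by (simp add: strand_path_def helix_dist_same_strand flip: N_def)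
    then have "(N * u) ^ 4 \<le> helix_dist (strand_path a s) (strand_path a t) ^ 4"
      using N u0 by (intro power_mono) auto
    then have "(N * u) ^ 4 / u ^ 3 \<le> helix_dist (strand_path a s) (strand_path a t) ^ 4 / u ^ 3"
      using u0 by (intro divide_right_mono) auto
    moreover have "(N * u) ^ 4 / u ^ 3 = N ^ 3 * (N * u)"
      using u0 by (simp add: power_mult_distrib eval_nat_numeral field_simps)
    moreover have "N ^ 3 * (1 / 8) \<le> N ^ 3 * (N * u)"
      using Nu(1) h(3) N by (intro mult_left_mono) simp_all
    moreover have "helix_dist (strand_path a s) (strand_path a t) powr 4 *
        \<bar>t - s\<bar> powr (- 1 - 1 / 2 * 4) = helix_dist (strand_path a s) (strand_path a t) ^ 4 / u ^ 3"
      using u0 powr_minus_divide[of u 3] by (simp add: u(4))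
    ultimately show ?thesis by linarith
  qed
  \<comment> \<open>The area h^2 = 1 / (64 N^2) times the lower bound N^3 / 8 of the integrand gives
    N / 512.\<close>
  have "emeasure (lborel \<Otimes>\<^sub>M lborel) A = ennreal h * ennreal h"
    unfolding A_def using h by (subst lborel.emeasure_pair_measure_Times) auto
  then have "ennreal (N / 512) = ennreal (N ^ 3 / 8) * emeasure (lborel \<Otimes>\<^sub>M lborel) A"
    using N h(1) by (simp add: h_def eval_nat_numeral field_simps flip: ennreal_mult)
  also have "\<dots> = (\<integral>\<^sup>+ z. ennreal (N ^ 3 / 8) * indicator A z \<partial>(lborel \<Otimes>\<^sub>M lborel))"
    by (rule nn_integral_cmult_indicator[symmetric]) (auto simp: A_def)
  also have "\<dots> \<le> (\<integral>\<^sup>+ z \<in> {0..1} \<times> {0..1}. ?f z \<partial>(lborel \<Otimes>\<^sub>M lborel))"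
  proof (intro nn_integral_mono)
    fix z :: "real \<times> real"
    obtain s t where z: "z = (s, t)" by (cases z)
    show "ennreal (N ^ 3 / 8) * indicator A z \<le> ?f z * indicator ({0..1} \<times> {0..1}) z"
    proof (cases "(s, t) \<in> A")
      case True
      then have "z \<in> {0..1} \<times> {0..1}" using A(1,2)[OF True] by (simp add: z)
      then show ?thesis using True ennreal_leI[OF bound[OF True]] by (simp add: z)
    qed (simp add: z)
  qed
  finally show ?thesis
    by (simp add: sobolev_seminorm_def enn_powr_inverse N_def)
qed

text \<open>Almost every path is the strand through its starting point, so its energy is bounded
  below by a measurable function of \<open>\<gamma> 0\<close>, whose law is
  \<open>curve 0\<close>.\<close>

lemma curve_lift_energy:
  "(\<integral>\<^sup>+ \<gamma>. enn_powr (sobolev_seminorm (mdist helix) (1 / 2) 4 1 \<gamma>) 4 \<partial>curve_lift) = \<infinity>"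
proof -
  let ?h = "\<lambda>x. ennreal (of_int (winding (fst (strand_of x))) / 512)"
  have eval: "(\<lambda>\<gamma>. \<gamma> 0) \<in> curve_lift \<rightarrow>\<^sub>M borel_metric helix"
    using eval_path_space_measurable[of 0 1 helix] by (simp add: curve_lift_def)
  \<comment> \<open>The weight of block \<open>n\<close> cancels its winding, so every block
    contributes the same 1/512 and the sum diverges.\<close>
  have "ennreal (pmf (geometric_pmf (1 / 2)) n) * ennreal (of_int (winding n) / 512) = ennreal (1 / 512)" for n
    by (simp add: winding_def field_simps flip: ennreal_mult')
  then have "(\<integral>\<^sup>+ n. ennreal (of_int (winding n) / 512) \<partial>geometric_pmf (1 / 2)) =
      (\<integral>\<^sup>+ n. ennreal (1 / 512) \<partial>count_space (UNIV :: nat set))"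
    by (simp add: nn_integral_measure_pmf)
  also have "\<dots> = \<infinity>" by (simp add: ennreal_mult_top)
  finally have "\<infinity> = (\<integral>\<^sup>+ x. ?h x \<partial>curve 0)"
    using nn_integral_curve[where f = "\<lambda>n. ennreal (of_int (winding n) / 512)" and t = 0] by simp
  also have "curve 0 = distr curve_lift (borel_metric helix) (\<lambda>\<gamma>. \<gamma> 0)"
    using curve_lift_in by (simp add: lifts_def)
  also have "(\<integral>\<^sup>+ x. ?h x \<partial>distr curve_lift (borel_metric helix) (\<lambda>\<gamma>. \<gamma> 0)) =
      (\<integral>\<^sup>+ \<gamma>. ?h (\<gamma> 0) \<partial>curve_lift)"
    by (rule nn_integral_distr[OF eval]) (simp add: measurable_block)
  also have "\<dots> \<le> (\<integral>\<^sup>+ \<gamma>. enn_powr (sobolev_seminorm (mdist helix) (1 / 2) 4 1 \<gamma>) 4 \<partial>curve_lift)"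
    using AE_lift_eq_strand_path[OF curve_lift_in]
  proof (intro nn_integral_mono_AE, eventually_elim)
    case (elim \<gamma>)
    then show ?case using strand_path_energy[of "strand_of (\<gamma> 0)"] by simp
  qed
  finally show ?thesis by (simp add: top_unique)
qed

theorem proposition1p10:
  shows "\<exists>(m :: (nat \<Rightarrow> real) metric) (T :: real) (p :: real) (\<alpha> :: real)
            (\<mu> :: real \<Rightarrow> (nat \<Rightarrow> real) measure).
           mcomplete_of m \<and> separable_space (mtopology_of m) \<and>
           0 < T \<and> 1 < p \<and> 1 / p < \<alpha> \<and> \<alpha> < 1 \<and>
           sobolev_path (prob_moment p m) (wasserstein p m) \<alpha> p T \<mu> \<and>
           \<not> compatible p m (\<mu> ` {0..T}) \<and>
           (\<exists>\<pi>. lifts T m \<mu> = {\<pi>} \<and>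
              (\<integral>\<^sup>+ \<gamma>. enn_powr (sobolev_seminorm (mdist m) \<alpha> p T \<gamma>) p \<partial>\<pi>) = \<infinity>)"
proof (intro exI conjI)
  show "mcomplete_of helix" by (rule helix_mcomplete)
  show "separable_space (mtopology_of helix)" by (rule helix_separable)
  show "sobolev_path (prob_moment 4 helix) (wasserstein 4 helix) (1 / 2) 4 1 curve"
    by (rule sobolev_path_curve)
  show "\<not> compatible 4 helix (curve ` {0..1})" by (rule not_compatible_curve)
  show "lifts 1 helix curve = {curve_lift}" by (rule lifts_curve)
  show "(\<integral>\<^sup>+ \<gamma>. enn_powr (sobolev_seminorm (mdist helix) (1 / 2) 4 1 \<gamma>) 4 \<partial>curve_lift) = \<infinity>"
    by (rule curve_lift_energy)
qed simp_all

end
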